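(* The concurrent linked-list map implementation described in the context (operations insert, remove, contains and rangeQuery, with auxiliary methods find and trim, ignoring memory reclamation and any external index) is lock-free: in every execution, if threads take sufficiently many steps, at least one thread completes its operation (there is no infinite execution suffix in which threads keep taking steps but no operation completes).
   Context: Model: asynchronous shared memory with threads communicating via atomic read, write, and compare-and-swap (CAS(addr, expected, new) atomically replaces the content of addr by new iff it equals expected, and returns whether it did). A shared integer clock globalTS, initially 2, is read atomically by getTS() and atomically fetched-and-incremented by fetchAddTS() (which returns the old value). A special constant $\bot = 1$ denotes an uninitialized timestamp. Pointers carry two low-order bits: a mark bit and a flag bit; a pointer is never both marked and flagged; getRef(p) strips the bits. mark(node) reads $p$ = node.next, returns false if $p$ is marked or flagged, else returns CAS(\&node.next, $p$, $p$ with mark bit set); flag(node) is the same with the flag bit. Node fields: ts (timestamp), key, value (immutable), next (pointer), prior (pointer, written once at initialization). alloc(k,v,$\bot$) creates a node with ts $=\bot$. Initialization: head = node with key $-\infty$, ts 2, prior NULL; tail = node with key $+\infty$, ts 2, next NULL, prior NULL; head.next = tail. find(key): retry: pred := head; predNext := pred.next; curr := getRef(predNext). Loop: while curr.next is marked or flagged { if getRef(curr.next) is NULL break; curr := getRef(curr.next) }; if curr.key $\ge$ key break; pred := curr; predNext := pred.next; if predNext is marked or flagged goto retry; curr := getRef(predNext). After the loop: CAS(\&pred.ts, $\bot$, getTS()). If predNext $\ne$ curr: if not trim(pred, getRef(predNext)) goto retry; predNext := pred.next; if predNext marked or flagged goto retry; curr := predNext; if curr.next is marked or flagged or curr.key <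 key goto retry. Then CAS(\&curr.ts, $\bot$, getTS()); return (pred, curr). trim(pred, victim): curr := victim; while curr.next is marked: curr := getRef(curr.next). CAS(\&curr.ts, $\bot$, getTS()). If flag(curr) fails and curr.next is not flagged, return false. succ := getRef(curr.next); if succ $\ne$ NULL then CAS(\&succ.ts, $\bot$, getTS()). newCurr := alloc(curr.key, curr.value, $\bot$); newCurr.next := succ; newCurr.prior := victim. If CAS(\&pred.next, victim, newCurr) succeeds: CAS(\&newCurr.ts, $\bot$, getTS()); return true. Otherwise return false. insert(key, val): repeat: (pred, curr) := find(key); if curr.key = key return curr.value; newNode := alloc(key, val, $\bot$); newNode.next := curr; newNode.prior := curr; if CAS(\&pred.next, curr, newNode) succeeds: CAS(\&newNode.ts, $\bot$, getTS()); return NO\_VAL. remove(key): repeat: (pred, curr) := find(key); if curr.key $\ne$ key return NO\_VAL; if not mark(curr) continue; find(key); return curr.value. contains(key): (pred, curr) := find(key); if curr.key $\ne$ key return NO\_VAL else return curr.value. rangeQuery(low, high, arr): ts := fetchAddTS(); currKey := low. Loop: (pred, curr) := find(currKey); currKey := pred.key; while pred.ts > ts: pred := pred.prior; if pred.key $\le$ low { curr := pred; break }; ts := getTS() $-1$. Then while curr.key < low: succ := getRef(curr.next); CAS(\&succ.ts, $\bot$, getTS()); while succ.ts > ts: succ := succ.prior; curr := succ. Then count := 0; while curr.key $\le$ high: arr[count] := (curr.key, curr.value); count := count+1; succ := getRef(curr.next); CAS(\&succ.ts, $\bot$, getTS()); while succ.ts > ts: succ := succ.prior; curr := succ. Return count.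 *)

theory Defs
  imports Main
begin

datatype 'k ekey = NegInf | Key 'k | PosInf

fun ekey_le :: "'k::linorder ekey \<Rightarrow> 'k ekey \<Rightarrow> bool" where
  "ekey_le NegInf _ = True"
| "ekey_le _ PosInf = True"
| "ekey_le (Key a) (Key b) = (a \<le> b)"
| "ekey_le _ _ = False"

definition ekey_lt :: "'k::linorder ekey \<Rightarrow> 'k ekey \<Rightarrow> bool" where
  "ekey_lt x y = (\<not> ekey_le y x)"

text \<open>Addresses; address 0 is NULL and is never allocated. Pointers carry mark and flag bits.\<close>

type_synonym addr = nat

datatype ptr = Ptr (ref: addr) (marked: bool) (flagged: bool)

definition NULL :: addr where "NULL = 0"
definition HEAD :: addr where "HEAD = 1"
definition TAIL :: addr where "TAIL = 2"
definition BOT :: nat where "BOT = 1"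

definition unm :: "addr \<Rightarrow> ptr" where "unm a = Ptr a False False"
definition mf :: "ptr \<Rightarrow> bool" where "mf p = (marked p \<or> flagged p)"
definition setmark :: "ptr \<Rightarrow> ptr" where "setmark p = Ptr (ref p) True (flagged p)"
definition setflag :: "ptr \<Rightarrow> ptr" where "setflag p = Ptr (ref p) (marked p) True"

record ('k, 'v) node =
  n_ts :: nat
  n_key :: "'k ekey"
  n_val :: 'v
  n_next :: ptr
  n_prior :: addr

record ('k, 'v) shared =
  s_mem :: "addr \<Rightarrow> ('k, 'v) node option"
  s_gts :: nat
  s_free :: addr   \<comment> \<open>bump allocator: next fresh address (no reclamation)\<close>

datatype ('k, 'v) oper = OIns 'k 'v | ORem 'k | OCon 'k | ORQ 'k 'k

text \<open>Continuation after a call of find.\<close>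
datatype fret = RIns | RRem1 | RRem2 | RCon | RRQ

datatype pc =
    Idle | Err
  | F_retry | F_loop | F_adv | F_ts1 | F_ts1c | F_post | F_post2 | F_ts2 | F_ts2c
  | T_loop | T_ts | T_tsc | T_flag1 | T_flag2 | T_chk | T_succ | T_sts | T_stsc
  | T_alloc | T_cas | T_nts | T_ntsc
  | I_chk | I_cas | I_ts | I_tsc
  | R_chk | R_mark1 | R_mark2 | R_fin
  | C_fin
  | Q_start | Q_a | Q_w | Q_wp | Q_ts
  | Q_s1 | Q_s1ts | Q_s1tsc | Q_s1w | Q_s1wp
  | Q_s2 | Q_s2ts | Q_s2tsc | Q_s2w | Q_s2wp

datatype act = AInv | AInt | ARet

record ('k, 'v) lst =
  l_op :: "('k, 'v) oper option"
  l_pc :: pc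
  l_fkey :: "'k ekey"
  l_fret :: fret
  l_pred :: addr
  l_curr :: addr
  l_pnext :: ptr
  l_tp :: ptr
  l_victim :: addr
  l_tcurr :: addr
  l_succ :: addr
  l_new :: addr
  l_tsv :: nat
  l_saved :: addr
  l_rts :: nat
  l_ckey :: "'k ekey"
  l_arr :: "('k ekey \<times> 'v) list"

type_synonym ('k, 'v) res = "('k, 'v) shared \<times> ('k, 'v) lst \<times> act"

definition goto :: "('k, 'v) shared \<Rightarrow> ('k, 'v) lst \<Rightarrow> pc \<Rightarrow> ('k, 'v) res" where
  "goto sh l p = (sh, l\<lparr>l_pc := p\<rparr>, AInt)"

text \<open>Accessing a non-allocated address (e.g. NULL) sends the thread to the error
  location Err, where it spins forever without completing (conservative choice).\<close>
definition withn :: "('k, 'v) shared \<Rightarrow> ('k, 'v) lst \<Rightarrow> addr \<Rightarrow> (('k, 'v) node \<Rightarrow> ('k, 'v) res) \<Rightarrow> ('k, 'v) res" where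
  "withn sh l a f = (case s_mem sh a of None \<Rightarrow> (sh, l\<lparr>l_pc := Err\<rparr>, AInt) | Some n \<Rightarrow> f n)"

definition setn :: "('k, 'v) shared \<Rightarrow> addr \<Rightarrow> ('k, 'v) node \<Rightarrow> ('k, 'v) shared" where
  "setn sh a n = sh\<lparr>s_mem := (s_mem sh)(a := Some n)\<rparr>"

text \<open>CAS(a.ts, BOT, v), where n is the current content of a.\<close>
definition cas_ts :: "('k, 'v) shared \<Rightarrow> addr \<Rightarrow> ('k, 'v) node \<Rightarrow> nat \<Rightarrow> ('k, 'v) shared" where
  "cas_ts sh a n v = (if n_ts n = BOT then setn sh a (n\<lparr>n_ts := v\<rparr>) else sh)"

definition mknode :: "nat \<Rightarrow> 'k ekey \<Rightarrow> 'v \<Rightarrow> ptr \<Rightarrow> addr \<Rightarrow> ('k, 'v) node" where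
  "mknode t k v nx pr = \<lparr>n_ts = t, n_key = k, n_val = v, n_next = nx, n_prior = pr\<rparr>"

definition alloc_sh :: "('k, 'v) shared \<Rightarrow> ('k, 'v) node \<Rightarrow> ('k, 'v) shared" where
  "alloc_sh sh nd = sh\<lparr>s_mem := (s_mem sh)(s_free sh := Some nd), s_free := Suc (s_free sh)\<rparr>"

fun retpc :: "fret \<Rightarrow> pc" where
  "retpc RIns = I_chk"
| "retpc RRem1 = R_chk"
| "retpc RRem2 = R_fin"
| "retpc RCon = C_fin"
| "retpc RRQ = Q_a"

definition ret :: "('k, 'v) shared \<Rightarrow> ('k, 'v) lst \<Rightarrow> ('k, 'v) res" where
  "ret sh l = (sh, l\<lparr>l_op := None, l_pc := Idle\<rparr>, ARet)"

definition rq_lo :: "('k, 'v) oper option \<Rightarrow> 'k ekey" where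
  "rq_lo o' = (case o' of Some (ORQ lo hi) \<Rightarrow> Key lo | _ \<Rightarrow> PosInf)"
definition rq_hi :: "('k, 'v) oper option \<Rightarrow> 'k ekey" where
  "rq_hi o' = (case o' of Some (ORQ lo hi) \<Rightarrow> Key hi | _ \<Rightarrow> NegInf)"

text \<open>One atomic step of a busy thread (exactly one shared-memory access, plus local computation;
  reads of the immutable fields key/value/prior are merged into neighbouring steps).\<close>
definition exec :: "('k::linorder, 'v) shared \<Rightarrow> ('k, 'v) lst \<Rightarrow> ('k, 'v) res" where
  "exec sh l = (case l_pc l of
    Idle \<Rightarrow> (sh, l, AInt)
  | Err \<Rightarrow> (sh, l, AInt)
  \<comment> \<open>find\<close>
  | F_retry \<Rightarrow> withn sh l HEAD (\<lambda>h.
      (sh, l\<lparr>l_pred := HEAD, l_pnext := n_next h, l_curr := ref (n_next h), l_pc := F_loop\<rparr>, AInt))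
  | F_loop \<Rightarrow> withn sh l (l_curr l) (\<lambda>c.
      if mf (n_next c) \<and> ref (n_next c) \<noteq> NULL then (sh, l\<lparr>l_curr := ref (n_next c)\<rparr>, AInt)
      else if ekey_le (l_fkey l) (n_key c) then goto sh l F_ts1
      else goto sh (l\<lparr>l_pred := l_curr l\<rparr>) F_adv)
  | F_adv \<Rightarrow> withn sh l (l_pred l) (\<lambda>p.
      if mf (n_next p) then goto sh (l\<lparr>l_pnext := n_next p\<rparr>) F_retry
      else (sh, l\<lparr>l_pnext := n_next p, l_curr := ref (n_next p), l_pc := F_loop\<rparr>, AInt))
  | F_ts1 \<Rightarrow> goto sh (l\<lparr>l_tsv := s_gts sh\<rparr>) F_ts1c
  | F_ts1c \<Rightarrow> withn sh l (l_pred l) (\<lambda>p.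
      (cas_ts sh (l_pred l) p (l_tsv l),
       if l_pnext l \<noteq> unm (l_curr l)
       then l\<lparr>l_victim := ref (l_pnext l), l_tcurr := ref (l_pnext l), l_pc := T_loop\<rparr>
       else l\<lparr>l_pc := F_ts2\<rparr>, AInt))
  | F_post \<Rightarrow> withn sh l (l_pred l) (\<lambda>p.
      if mf (n_next p) then goto sh (l\<lparr>l_pnext := n_next p\<rparr>) F_retry
      else (sh, l\<lparr>l_pnext := n_next p, l_curr := ref (n_next p), l_pc := F_post2\<rparr>, AInt))
  | F_post2 \<Rightarrow> withn sh l (l_curr l) (\<lambda>c.
      if mf (n_next c) \<or> ekey_lt (n_key c) (l_fkey l) then goto sh l F_retry else goto sh l F_ts2)
  | F_ts2 \<Rightarrow> goto sh (l\<lparr>l_tsv := s_gts sh\<rparr>) F_ts2c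
  | F_ts2c \<Rightarrow> withn sh l (l_curr l) (\<lambda>c.
      (cas_ts sh (l_curr l) c (l_tsv l), l\<lparr>l_pc := retpc (l_fret l)\<rparr>, AInt))
  \<comment> \<open>trim(pred, victim); returning false = goto F_retry, returning true = goto F_post\<close>
  | T_loop \<Rightarrow> withn sh l (l_tcurr l) (\<lambda>c.
      if marked (n_next c) then (sh, l\<lparr>l_tcurr := ref (n_next c)\<rparr>, AInt) else goto sh l T_ts)
  | T_ts \<Rightarrow> goto sh (l\<lparr>l_tsv := s_gts sh\<rparr>) T_tsc
  | T_tsc \<Rightarrow> withn sh l (l_tcurr l) (\<lambda>c.
      (cas_ts sh (l_tcurr l) c (l_tsv l), l\<lparr>l_pc := T_flag1\<rparr>, AInt))
  | T_flag1 \<Rightarrow> withn sh l (l_tcurr l) (\<lambda>c.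
      if mf (n_next c) then goto sh l T_chk else goto sh (l\<lparr>l_tp := n_next c\<rparr>) T_flag2)
  | T_flag2 \<Rightarrow> withn sh l (l_tcurr l) (\<lambda>c.
      if n_next c = l_tp l
      then (setn sh (l_tcurr l) (c\<lparr>n_next := setflag (l_tp l)\<rparr>), l\<lparr>l_pc := T_succ\<rparr>, AInt)
      else goto sh l T_chk)
  | T_chk \<Rightarrow> withn sh l (l_tcurr l) (\<lambda>c.
      if flagged (n_next c) then goto sh l T_succ else goto sh l F_retry)
  | T_succ \<Rightarrow> withn sh l (l_tcurr l) (\<lambda>c.
      goto sh (l\<lparr>l_succ := ref (n_next c)\<rparr>) (if ref (n_next c) \<noteq> NULL then T_sts else T_alloc))
  | T_sts \<Rightarrow> goto sh (l\<lparr>l_tsv := s_gts sh\<rparr>) T_stsc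
  | T_stsc \<Rightarrow> withn sh l (l_succ l) (\<lambda>s.
      (cas_ts sh (l_succ l) s (l_tsv l), l\<lparr>l_pc := T_alloc\<rparr>, AInt))
  | T_alloc \<Rightarrow> withn sh l (l_tcurr l) (\<lambda>c.
      (alloc_sh sh (mknode BOT (n_key c) (n_val c) (unm (l_succ l)) (l_victim l)),
       l\<lparr>l_new := s_free sh, l_pc := T_cas\<rparr>, AInt))
  | T_cas \<Rightarrow> withn sh l (l_pred l) (\<lambda>p.
      if n_next p = unm (l_victim l)
      then (setn sh (l_pred l) (p\<lparr>n_next := unm (l_new l)\<rparr>), l\<lparr>l_pc := T_nts\<rparr>, AInt)
      else goto sh l F_retry)
  | T_nts \<Rightarrow> goto sh (l\<lparr>l_tsv := s_gts sh\<rparr>) T_ntsc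
  | T_ntsc \<Rightarrow> withn sh l (l_new l) (\<lambda>n.
      (cas_ts sh (l_new l) n (l_tsv l), l\<lparr>l_pc := F_post\<rparr>, AInt))
  \<comment> \<open>insert\<close>
  | I_chk \<Rightarrow> withn sh l (l_curr l) (\<lambda>c.
      if n_key c = l_fkey l then ret sh l
      else (case l_op l of
              Some (OIns k v) \<Rightarrow>
                (alloc_sh sh (mknode BOT (Key k) v (unm (l_curr l)) (l_curr l)),
                 l\<lparr>l_new := s_free sh, l_pc := I_cas\<rparr>, AInt)
            | _ \<Rightarrow> goto sh l Err))
  | I_cas \<Rightarrow> withn sh l (l_pred l) (\<lambda>p.
      if n_next p = unm (l_curr l)
      then (setn sh (l_pred l) (p\<lparr>n_next := unm (l_new l)\<rparr>), l\<lparr>l_pc := I_ts\<rparr>, AInt)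
      else goto sh (l\<lparr>l_fret := RIns\<rparr>) F_retry)
  | I_ts \<Rightarrow> goto sh (l\<lparr>l_tsv := s_gts sh\<rparr>) I_tsc
  | I_tsc \<Rightarrow> withn sh l (l_new l) (\<lambda>n. ret (cas_ts sh (l_new l) n (l_tsv l)) l)
  \<comment> \<open>remove\<close>
  | R_chk \<Rightarrow> withn sh l (l_curr l) (\<lambda>c.
      if n_key c \<noteq> l_fkey l then ret sh l else goto sh l R_mark1)
  | R_mark1 \<Rightarrow> withn sh l (l_curr l) (\<lambda>c.
      if mf (n_next c) then goto sh (l\<lparr>l_fret := RRem1\<rparr>) F_retry
      else goto sh (l\<lparr>l_tp := n_next c\<rparr>) R_mark2)
  | R_mark2 \<Rightarrow> withn sh l (l_curr l) (\<lambda>c.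
      if n_next c = l_tp l
      then (setn sh (l_curr l) (c\<lparr>n_next := setmark (l_tp l)\<rparr>),
            l\<lparr>l_saved := l_curr l, l_fret := RRem2, l_pc := F_retry\<rparr>, AInt)
      else goto sh (l\<lparr>l_fret := RRem1\<rparr>) F_retry)
  | R_fin \<Rightarrow> withn sh l (l_saved l) (\<lambda>c. ret sh l)
  \<comment> \<open>contains\<close>
  | C_fin \<Rightarrow> withn sh l (l_curr l) (\<lambda>c. ret sh l)
  \<comment> \<open>rangeQuery(low, high)\<close>
  | Q_start \<Rightarrow> (sh\<lparr>s_gts := Suc (s_gts sh)\<rparr>,
      l\<lparr>l_rts := s_gts sh, l_ckey := rq_lo (l_op l), l_arr := [],
        l_fkey := rq_lo (l_op l), l_fret := RRQ, l_pc := F_retry\<rparr>, AInt)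
  | Q_a \<Rightarrow> withn sh l (l_pred l) (\<lambda>p. goto sh (l\<lparr>l_ckey := n_key p\<rparr>) Q_w)
  | Q_w \<Rightarrow> withn sh l (l_pred l) (\<lambda>p.
      if n_ts p > l_rts l then goto sh l Q_wp
      else if ekey_le (n_key p) (rq_lo (l_op l)) then goto sh (l\<lparr>l_curr := l_pred l\<rparr>) Q_s1
      else goto sh l Q_ts)
  | Q_wp \<Rightarrow> withn sh l (l_pred l) (\<lambda>p. goto sh (l\<lparr>l_pred := n_prior p\<rparr>) Q_w)
  | Q_ts \<Rightarrow> goto sh (l\<lparr>l_rts := s_gts sh - 1, l_fkey := l_ckey l, l_fret := RRQ\<rparr>) F_retry
  | Q_s1 \<Rightarrow> withn sh l (l_curr l) (\<lambda>c.
      if ekey_lt (n_key c) (rq_lo (l_op l)) then goto sh (l\<lparr>l_succ := ref (n_next c)\<rparr>) Q_s1ts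
      else goto sh l Q_s2)
  | Q_s1ts \<Rightarrow> goto sh (l\<lparr>l_tsv := s_gts sh\<rparr>) Q_s1tsc
  | Q_s1tsc \<Rightarrow> withn sh l (l_succ l) (\<lambda>s.
      (cas_ts sh (l_succ l) s (l_tsv l), l\<lparr>l_pc := Q_s1w\<rparr>, AInt))
  | Q_s1w \<Rightarrow> withn sh l (l_succ l) (\<lambda>s.
      if n_ts s > l_rts l then goto sh l Q_s1wp else goto sh (l\<lparr>l_curr := l_succ l\<rparr>) Q_s1)
  | Q_s1wp \<Rightarrow> withn sh l (l_succ l) (\<lambda>s. goto sh (l\<lparr>l_succ := n_prior s\<rparr>) Q_s1w)
  | Q_s2 \<Rightarrow> withn sh l (l_curr l) (\<lambda>c.
      if ekey_le (n_key c) (rq_hi (l_op l))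
      then goto sh (l\<lparr>l_arr := l_arr l @ [(n_key c, n_val c)], l_succ := ref (n_next c)\<rparr>) Q_s2ts
      else ret sh l)
  | Q_s2ts \<Rightarrow> goto sh (l\<lparr>l_tsv := s_gts sh\<rparr>) Q_s2tsc
  | Q_s2tsc \<Rightarrow> withn sh l (l_succ l) (\<lambda>s.
      (cas_ts sh (l_succ l) s (l_tsv l), l\<lparr>l_pc := Q_s2w\<rparr>, AInt))
  | Q_s2w \<Rightarrow> withn sh l (l_succ l) (\<lambda>s.
      if n_ts s > l_rts l then goto sh l Q_s2wp else goto sh (l\<lparr>l_curr := l_succ l\<rparr>) Q_s2)
  | Q_s2wp \<Rightarrow> withn sh l (l_succ l) (\<lambda>s. goto sh (l\<lparr>l_succ := n_prior s\<rparr>) Q_s2w))"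

fun invoke :: "('k, 'v) oper \<Rightarrow> ('k, 'v) lst \<Rightarrow> ('k, 'v) lst" where
  "invoke (OIns k v) l = l\<lparr>l_op := Some (OIns k v), l_fkey := Key k, l_fret := RIns, l_pc := F_retry\<rparr>"
| "invoke (ORem k) l = l\<lparr>l_op := Some (ORem k), l_fkey := Key k, l_fret := RRem1, l_pc := F_retry\<rparr>"
| "invoke (OCon k) l = l\<lparr>l_op := Some (OCon k), l_fkey := Key k, l_fret := RCon, l_pc := F_retry\<rparr>"
| "invoke (ORQ lo hi) l = l\<lparr>l_op := Some (ORQ lo hi), l_pc := Q_start\<rparr>"

type_synonym ('k, 'v, 't) gstate = "('k, 'v) shared \<times> ('t \<Rightarrow> ('k, 'v) lst)"

inductive gstep :: "('k::linorder, 'v, 't) gstate \<Rightarrow> 't \<Rightarrow> act \<Rightarrow> ('k, 'v, 't) gstate \<Rightarrow> bool" where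
  invoke_step: "l_op (L t) = None \<Longrightarrow> gstep (sh, L) t AInv (sh, L(t := invoke opn (L t)))"
| exec_step: "l_op (L t) \<noteq> None \<Longrightarrow> exec sh (L t) = (sh', l', a) \<Longrightarrow> gstep (sh, L) t a (sh', L(t := l'))"

definition is_init :: "('k, 'v, 't) gstate \<Rightarrow> bool" where
  "is_init st = ((\<exists>v1 v2. s_mem (fst st) =
        (\<lambda>a. None)(HEAD := Some (mknode 2 NegInf v1 (unm TAIL) NULL),
                   TAIL := Some (mknode 2 PosInf v2 (unm NULL) NULL)))
     \<and> s_gts (fst st) = 2 \<and> s_free (fst st) = 3
     \<and> (\<forall>t. l_op (snd st t) = None \<and> l_pc (snd st t) = Idle))"

end

(*
  Suppose that from some point on no operation completes. Each pending operation performs at most one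
  successful insertion or logical deletion (marking), so eventually there are none. From then on the
  marked nodes are fixed, and only the immediate successor of a marked node can be newly flagged, so
  eventually no flag is set. Then the set of frozen (marked or flagged) nodes is fixed, and every
  successful CAS of trim bypasses a frozen node: a weight of the published pointers, counting the
  frozen nodes ahead of them, decreases. Hence eventually the published pointers never change, and
  then every thread on its own runs out of steps: a find started afterwards never retries, and the
  loops of rangeQuery follow strictly decreasing addresses (prior) and strictly monotone keys.
  The last point needs the history invariant "good" on timestamps.
*)
theory Submission
  imports Defs
begin

section \<open>Keys, memory and its invariant\<close>

text \<open>The memory as a whole need not settle: failing attempts may keep allocating nodes. What
  settles are the next fields of published nodes, so the final measure is built from these fields,
  the keys and the locals of one thread; it mentions neither the clock nor any timestamp. A thread
  whose reads agree with the settled fields would succeed with its next pointer CAS and thereby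
  change them, so such a thread cannot retry. Since a thread that dereferences NULL spins in
  \<open>Err\<close>, lock-freedom includes memory safety. This is where the constants 2 and 3 come
  from: a node without a prior has timestamp 2, and every bound of a range query is at least 2, so a
  walk along priors stops before NULL. The bound stays at least 2 because the clock is at least 3
  after the initial fetch-and-increment and a refreshed bound is the clock minus 1.\<close>

instantiation ekey :: (linorder) linorder
begin

definition "less_eq_ekey = (ekey_le :: 'a ekey \<Rightarrow> 'a ekey \<Rightarrow> bool)"
definition "less_ekey = (ekey_lt :: 'a ekey \<Rightarrow> 'a ekey \<Rightarrow> bool)"

instance
proof
  fix x y z :: "'a ekey"
  show tot: "x \<le> y \<or> y \<le> x"
    unfolding less_eq_ekey_def by (cases x; cases y) auto
  show "x \<le> x"
    unfolding less_eq_ekey_def by (cases x) auto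
  show "x \<le> y \<Longrightarrow> y \<le> z \<Longrightarrow> x \<le> z"
    unfolding less_eq_ekey_def by (cases x; cases y; cases z) auto
  show "x \<le> y \<Longrightarrow> y \<le> x \<Longrightarrow> x = y"
    unfolding less_eq_ekey_def by (cases x; cases y) auto
  show "x < y \<longleftrightarrow> x \<le> y \<and> \<not> y \<le> x"
    using tot unfolding less_ekey_def less_eq_ekey_def ekey_lt_def by auto
qed

end

lemma ekey_le_iff [simp]: "ekey_le x y \<longleftrightarrow> x \<le> y"
  by (simp add: less_eq_ekey_def)

lemma ekey_lt_iff [simp]: "ekey_lt x y \<longleftrightarrow> x < y"
  by (simp add: less_ekey_def)

lemma NegInf_le [simp]: "NegInf \<le> x"
  unfolding ekey_le_iff[symmetric] by (cases x) (simp_all del: ekey_le_iff)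

lemma le_PosInf [simp]: "x \<le> PosInf"
  unfolding ekey_le_iff[symmetric] by (cases x) (simp_all del: ekey_le_iff)

lemma not_less_NegInf [simp]: "\<not> x < NegInf" "\<not> PosInf < x"
  by (simp_all add: not_less)

lemma NegInf_less_iff [simp]: "NegInf < x \<longleftrightarrow> x \<noteq> NegInf"
  by (auto simp: less_le)

lemma not_PosInf_le_Key [simp]: "\<not> PosInf \<le> Key k"
  unfolding ekey_le_iff[symmetric] by (simp del: ekey_le_iff)

section \<open>Published addresses, prior chains and the memory invariant\<close>

definition alloced :: "('k, 'v) shared \<Rightarrow> addr \<Rightarrow> bool" where
  "alloced sh b \<longleftrightarrow> s_mem sh b \<noteq> None"

definition nd :: "('k, 'v) shared \<Rightarrow> addr \<Rightarrow> ('k, 'v) node" where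
  "nd sh b = the (s_mem sh b)"

abbreviation "tsn sh b \<equiv> n_ts (nd sh b)"
abbreviation "kyn sh b \<equiv> n_key (nd sh b)"
abbreviation "nxn sh b \<equiv> n_next (nd sh b)"
abbreviation "prn sh b \<equiv> n_prior (nd sh b)"

lemma withn_alloced [simp]: "alloced sh b \<Longrightarrow> withn sh l b f = f (nd sh b)"
  by (auto simp: withn_def nd_def alloced_def)

text \<open>The published addresses. A node allocated by a pending CAS is not the target of any pointer,
  and a node unlinked by a CAS stays the prior of its replacement, so this set only grows.\<close>

definition pub :: "('k, 'v) shared \<Rightarrow> addr set" where
  "pub sh = insert HEAD {b. b \<noteq> NULL \<and>
     (\<exists>c. alloced sh c \<and> (ref (nxn sh c) = b \<or> prn sh c = b))}"

lemma pub_next: "alloced sh b \<Longrightarrow> ref (nxn sh b) \<noteq> NULL \<Longrightarrow> ref (nxn sh b) \<in> pub sh"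
  by (auto simp: pub_def)

lemma pub_prior: "alloced sh b \<Longrightarrow> prn sh b \<noteq> NULL \<Longrightarrow> prn sh b \<in> pub sh"
  by (auto simp: pub_def)

lemma NULL_notin_pub [simp]: "NULL \<notin> pub sh"
  by (simp add: pub_def NULL_def HEAD_def)

text \<open>Following prior pointers from \<open>s\<close>, all keys exceed that of \<open>c\<close> at least until
  a node not younger than \<open>c\<close> is met. This is what makes the walk of a range query
  advance to strictly larger keys.\<close>

inductive good :: "('k::linorder, 'v) shared \<Rightarrow> addr \<Rightarrow> addr \<Rightarrow> bool"
  for sh :: "('k, 'v) shared" and c :: addr where
  good_stop: "alloced sh s \<Longrightarrow> kyn sh c < kyn sh s \<Longrightarrow> tsn sh s \<noteq> BOT \<Longrightarrow> tsn sh s \<le> tsn sh c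
    \<Longrightarrow> good sh c s"
| good_prior: "alloced sh s \<Longrightarrow> kyn sh c < kyn sh s \<Longrightarrow> good sh c (prn sh s) \<Longrightarrow> good sh c s"

lemma good_key: "good sh c s \<Longrightarrow> kyn sh c < kyn sh s"
  by (cases rule: good.cases) auto

lemma good_priorD: "good sh c s \<Longrightarrow> tsn sh c < tsn sh s \<Longrightarrow> good sh c (prn sh s)"
  by (cases rule: good.cases) auto

text \<open>Pointer CASes are applied to stamped nodes only, so an unstamped node still has the next
  field given at allocation, whose target was stamped beforehand (\<open>next_ts\<close>). The bump
  allocator gives every prior a smaller address (\<open>prior_less\<close>). A flag can be set on a
  node whose next is NULL, a mark cannot (\<open>marked_next\<close>), because only nodes with a
  proper key are removed.\<close>

locale wf_mem =
  fixes sh :: "('k::linorder, 'v) shared"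
  assumes alloced_iff: "alloced sh b \<longleftrightarrow> 0 < b \<and> b < s_free sh"
    and head: "alloced sh HEAD" "kyn sh HEAD = NegInf" "tsn sh HEAD = 2" "\<not> mf (nxn sh HEAD)"
    and gts_ge: "2 \<le> s_gts sh"
    and prior_NULL: "alloced sh b \<Longrightarrow> prn sh b = NULL \<Longrightarrow> tsn sh b = 2"
    and prior_less: "alloced sh b \<Longrightarrow> prn sh b \<noteq> NULL \<Longrightarrow> prn sh b < b"
    and prior_ts: "alloced sh b \<Longrightarrow> prn sh b \<noteq> NULL \<Longrightarrow> tsn sh (prn sh b) \<noteq> BOT"
    and key_NegInf: "alloced sh b \<Longrightarrow> kyn sh b = NegInf \<Longrightarrow> b = HEAD"
    and next_NULL: "alloced sh b \<Longrightarrow> ref (nxn sh b) = NULL \<Longrightarrow> kyn sh b = PosInf"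
    and next_alloced: "alloced sh b \<Longrightarrow> ref (nxn sh b) \<noteq> NULL \<Longrightarrow> alloced sh (ref (nxn sh b))"
    and next_key: "alloced sh b \<Longrightarrow> ref (nxn sh b) \<noteq> NULL \<Longrightarrow> kyn sh b < kyn sh (ref (nxn sh b))"
    and mf_ts: "alloced sh b \<Longrightarrow> mf (nxn sh b) \<Longrightarrow> tsn sh b \<noteq> BOT"
    and marked_next: "alloced sh b \<Longrightarrow> marked (nxn sh b) \<Longrightarrow> ref (nxn sh b) \<noteq> NULL"
    and next_ts: "alloced sh b \<Longrightarrow> tsn sh b = BOT \<Longrightarrow> ref (nxn sh b) \<noteq> NULL
      \<Longrightarrow> tsn sh (ref (nxn sh b)) \<noteq> BOT"
    and ts_le_gts: "alloced sh b \<Longrightarrow> tsn sh b \<le> s_gts sh"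
    and next_good: "alloced sh b \<Longrightarrow> tsn sh b \<noteq> BOT \<Longrightarrow> ref (nxn sh b) \<noteq> NULL
      \<Longrightarrow> good sh b (ref (nxn sh b))"
begin

lemmas wf_intros = prior_NULL prior_less next_NULL next_alloced next_key ts_le_gts
lemmas wf_dests = prior_ts mf_ts marked_next next_ts

lemma prior_alloced: "alloced sh b \<Longrightarrow> prn sh b \<noteq> NULL \<Longrightarrow> alloced sh (prn sh b)"
  using prior_less[of b] by (auto simp: alloced_iff NULL_def)

lemma pub_alloced: "b \<in> pub sh \<Longrightarrow> alloced sh b"
  using head(1) next_alloced prior_alloced by (auto simp: pub_def)

lemma finite_alloced: "finite {b. alloced sh b}"
  by (simp add: alloced_iff)

lemma finite_pub: "finite (pub sh)"
  by (rule finite_subset[OF _ finite_alloced]) (auto simp: pub_alloced)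

lemma head_pub: "HEAD \<in> pub sh"
  by (simp add: pub_def)

lemma free_notin_pub: "s_free sh \<notin> pub sh"
  using pub_alloced by (auto simp: alloced_iff)

lemma key_PosInf_iff: "alloced sh b \<Longrightarrow> kyn sh b = PosInf \<longleftrightarrow> ref (nxn sh b) = NULL"
  using next_NULL[of b] next_key[of b] by (cases "ref (nxn sh b) = NULL") auto

lemma next_pub: "b \<in> pub sh \<Longrightarrow> kyn sh b \<noteq> PosInf \<Longrightarrow> ref (nxn sh b) \<in> pub sh"
  using next_NULL pub_alloced pub_next by blast

end

text \<open>The rely relation between threads. Each of the three cases that keep a next field has
  its purpose: frozen nodes for \<open>trim\<close>, nodes that remain unstamped for pending
  timestamps (\<open>tsv_ok\<close>), unpublished nodes for pending CASes.\<close>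

definition grows :: "('k::linorder, 'v) shared \<Rightarrow> ('k, 'v) shared \<Rightarrow> bool" where
  "grows sh sh' \<longleftrightarrow> s_gts sh \<le> s_gts sh' \<and> pub sh \<subseteq> pub sh' \<and>
     (\<forall>b. alloced sh b \<longrightarrow> alloced sh' b \<and> kyn sh' b = kyn sh b \<and> prn sh' b = prn sh b \<and>
        (tsn sh b \<noteq> BOT \<longrightarrow> tsn sh' b = tsn sh b) \<and>
        (mf (nxn sh b) \<or> tsn sh' b = BOT \<or> b \<notin> pub sh \<longrightarrow> nxn sh' b = nxn sh b))"

lemma growsD:
  assumes "grows sh sh'" "alloced sh b"
  shows "alloced sh' b" "kyn sh' b = kyn sh b" "prn sh' b = prn sh b"
    "tsn sh b \<noteq> BOT \<Longrightarrow> tsn sh' b = tsn sh b" "mf (nxn sh b) \<Longrightarrow> nxn sh' b = nxn sh b"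
    "tsn sh' b = BOT \<Longrightarrow> nxn sh' b = nxn sh b" "b \<notin> pub sh \<Longrightarrow> nxn sh' b = nxn sh b"
  using assms by (simp_all add: grows_def)

lemma grows_good:
  assumes g: "grows sh sh'" and c: "alloced sh c" "tsn sh c \<noteq> BOT" and "good sh c s"
  shows "good sh' c s"
  using assms(4)
proof induction
  case (good_stop s)
  then show ?case
    using growsD[OF g c(1)] growsD[OF g good_stop(1)] c(2) by (intro good.good_stop) simp_all
next
  case (good_prior s)
  then show ?case
    using growsD[OF g c(1)] growsD[OF g good_prior(1)] by (simp add: good.good_prior)
qed

lemma grows_refl [simp]: "grows sh sh"
  by (simp add: grows_def)

text \<open>The pending CAS of \<open>v\<close> into the timestamp of \<open>c\<close> will not make \<open>c\<close> older than its successor.\<close>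

definition tsv_ok :: "('k::linorder, 'v) shared \<Rightarrow> nat \<Rightarrow> addr \<Rightarrow> bool" where
  "tsv_ok sh v c \<longleftrightarrow> 2 \<le> v \<and> v \<le> s_gts sh \<and>
     (tsn sh c = BOT \<longrightarrow> ref (nxn sh c) \<noteq> NULL \<longrightarrow> tsn sh (ref (nxn sh c)) \<le> v)"

lemma nd_setn: "nd (setn sh a n) b = (if b = a then n else nd sh b)"
  by (simp add: nd_def setn_def)

lemma alloced_setn: "alloced (setn sh a n) b \<longleftrightarrow> b = a \<or> alloced sh b"
  by (simp add: alloced_def setn_def)

lemma setn_fields [simp]: "s_gts (setn sh a n) = s_gts sh" "s_free (setn sh a n) = s_free sh"
  by (simp_all add: setn_def)

lemma nd_alloc: "nd (alloc_sh sh n) b = (if b = s_free sh then n else nd sh b)"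
  by (simp add: nd_def alloc_sh_def)

lemma alloced_alloc: "alloced (alloc_sh sh n) b \<longleftrightarrow> b = s_free sh \<or> alloced sh b"
  by (simp add: alloced_def alloc_sh_def)

lemma alloc_fields [simp]: "s_gts (alloc_sh sh n) = s_gts sh" "s_free (alloc_sh sh n) = Suc (s_free sh)"
  by (simp_all add: alloc_sh_def)

lemma unm_sel [simp]: "ref (unm b) = b" "\<not> marked (unm b)" "\<not> flagged (unm b)" "\<not> mf (unm b)"
  by (simp_all add: unm_def mf_def)

lemma unm_ref: "\<not> mf p \<Longrightarrow> unm (ref p) = p"
  by (cases p) (simp add: unm_def mf_def)

lemma unm_eq_iff [simp]: "unm b = unm c \<longleftrightarrow> b = c"
  by (simp add: unm_def)

lemma setmark_sel [simp]: "ref (setmark p) = ref p" "marked (setmark p)" "mf (setmark p)"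
  "flagged (setmark p) = flagged p"
  by (simp_all add: setmark_def mf_def)

lemma setflag_sel [simp]: "ref (setflag p) = ref p" "flagged (setflag p)" "mf (setflag p)"
  "marked (setflag p) = marked p"
  by (simp_all add: setflag_def mf_def)

lemma mknode_sel [simp]: "n_ts (mknode t k v p q) = t" "n_key (mknode t k v p q) = k"
  "n_val (mknode t k v p q) = v" "n_next (mknode t k v p q) = p" "n_prior (mknode t k v p q) = q"
  by (simp_all add: mknode_def)

section \<open>Preservation of the memory invariant by the elementary updates\<close>

context wf_mem
begin

lemma tick:
  defines "sh' \<equiv> sh\<lparr>s_gts := Suc (s_gts sh)\<rparr>"
  shows "wf_mem sh'" "grows sh sh'" "pub sh' = pub sh" "nd sh' = nd sh"
proof -
  have 1 [simp]: "nd sh' = nd sh" "alloced sh' = alloced sh" "s_free sh' = s_free sh"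
    "s_gts sh' = Suc (s_gts sh)"
    by (auto simp: sh'_def nd_def alloced_def)
  show 2: "pub sh' = pub sh" by (simp add: pub_def)
  show g: "grows sh sh'" by (simp add: grows_def 2)
  show "nd sh' = nd sh" by simp
  show "wf_mem sh'"
  proof
    show "b = HEAD" if "alloced sh' b" "kyn sh' b = NegInf" for b
      using key_NegInf[of b] that by simp
    show "alloced sh' b \<longleftrightarrow> 0 < b \<and> b < s_free sh'" for b
      using alloced_iff by simp
    show "good sh' b (ref (nxn sh' b))"
      if "alloced sh' b" "tsn sh' b \<noteq> BOT" "ref (nxn sh' b) \<noteq> NULL" for b
      using that grows_good[OF g] next_good by simp
    show "2 \<le> s_gts sh'" using gts_ge by simp
    show "tsn sh' b \<le> s_gts sh'" if "alloced sh' b" for b using ts_le_gts[of b] that by simp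
  qed (auto simp: head intro: wf_intros dest: wf_dests)
qed

text \<open>Only the newly stamped node can endanger \<open>next_good\<close>. Its successor is
  already stamped, with a value not above \<open>v\<close>, so \<open>good_stop\<close> applies
  immediately.\<close>

lemma cas_ts_wf:
  assumes a: "a \<in> pub sh" and v: "tsv_ok sh v a"
  defines "sh' \<equiv> cas_ts sh a (nd sh a) v"
  shows "wf_mem sh'" "grows sh sh'" "pub sh' = pub sh" "nxn sh' b = nxn sh b" "kyn sh' b = kyn sh b"
    "tsn sh' a \<noteq> BOT" "s_gts sh' = s_gts sh"
proof -
  have al: "alloced sh a" using a pub_alloced by blast
  have B [simp]: "v \<noteq> BOT" using v by (auto simp: tsv_ok_def BOT_def)
  have [simp]: "alloced sh' b \<longleftrightarrow> alloced sh b" for b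
    using al by (auto simp: sh'_def cas_ts_def alloced_setn)
  have n [simp]: "nxn sh' b = nxn sh b" "kyn sh' b = kyn sh b" "prn sh' b = prn sh b" for b
    by (auto simp: sh'_def cas_ts_def nd_setn)
  have t: "tsn sh' b = (if b = a \<and> tsn sh a = BOT then v else tsn sh b)" for b
    by (auto simp: sh'_def cas_ts_def nd_setn)
  have [simp]: "s_gts sh' = s_gts sh" "s_free sh' = s_free sh"
    by (auto simp: sh'_def cas_ts_def)
  show p: "pub sh' = pub sh" by (simp add: pub_def)
  show g: "grows sh sh'" by (simp add: grows_def p t)
  show "nxn sh' b = nxn sh b" "kyn sh' b = kyn sh b" "tsn sh' a \<noteq> BOT" "s_gts sh' = s_gts sh"
    by (simp_all add: t)
  show "wf_mem sh'"
  proof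
    fix b
    show "good sh' b (ref (nxn sh' b))"
      if b: "alloced sh' b" "tsn sh' b \<noteq> BOT" "ref (nxn sh' b) \<noteq> NULL"
    proof (cases "tsn sh b = BOT")
      case True
      then have [simp]: "b = a" using b by (auto simp: t split: if_splits)
      have "ref (nxn sh a) \<noteq> a" using next_key[OF al] b by auto
      then show ?thesis
        using b True v al next_key[of a] next_ts[of a] next_alloced[of a]
        by (intro good.good_stop) (auto simp: t tsv_ok_def)
    next
      case False
      then show ?thesis using b grows_good[OF g] next_good by auto
    qed
    show "b = HEAD" if "alloced sh' b" "kyn sh' b = NegInf"
      using key_NegInf[of b] that by simp
    show "tsn sh' b = 2" if "alloced sh' b" "prn sh' b = NULL"
      using prior_NULL[of b] that by (auto simp: t BOT_def)
    show "tsn sh' b \<le> s_gts sh'" if "alloced sh' b"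
      using ts_le_gts[of b] v that by (auto simp: t tsv_ok_def)
    show "tsn sh' HEAD = 2" using head by (auto simp: t BOT_def)
    show "alloced sh' b \<longleftrightarrow> 0 < b \<and> b < s_free sh'"
      using alloced_iff by simp
  qed (auto simp: t head gts_ge intro: wf_intros dest: wf_dests split: if_splits)
qed

text \<open>The new node refers only to published nodes and no pointer refers to it, hence the
  published set is unchanged until a CAS links the node.\<close>

lemma alloc_wf:
  fixes v :: 'v
  assumes q: "q \<in> pub sh" "tsn sh q \<noteq> BOT" and k: "k \<noteq> NegInf"
    and s: "s = NULL \<longleftrightarrow> k = PosInf" "s \<noteq> NULL \<Longrightarrow> s \<in> pub sh \<and> k < kyn sh s \<and> tsn sh s \<noteq> BOT"
  defines "sh' \<equiv> alloc_sh sh (mknode BOT k v (unm s) q)"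
  shows "wf_mem sh'" "grows sh sh'" "pub sh' = pub sh" "alloced sh b \<Longrightarrow> nd sh' b = nd sh b"
    "s_gts sh' = s_gts sh"
    "alloced sh' (s_free sh)" "nd sh' (s_free sh) = mknode BOT k v (unm s) q"
proof -
  have al [simp]: "alloced sh q" "s \<noteq> NULL \<Longrightarrow> alloced sh s" using s q pub_alloced by blast+
  have pos: "0 < s_free sh" and [simp]: "\<not> alloced sh (s_free sh)"
    using head(1) by (auto simp: alloced_iff)
  have qN: "q \<noteq> NULL" "q \<noteq> s_free sh" using q free_notin_pub by auto
  have A: "alloced sh' b \<longleftrightarrow> b = s_free sh \<or> alloced sh b" for b
    by (simp add: sh'_def alloced_alloc)
  have N: "nd sh' b = (if b = s_free sh then mknode BOT k v (unm s) q else nd sh b)" for b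
    by (simp add: sh'_def nd_alloc)
  have ne: "b \<noteq> s_free sh" "ref (nxn sh b) \<noteq> s_free sh" if "alloced sh b" for b
    using that next_alloced[of b] pos by (auto simp: NULL_def)
  have [simp]: "s_gts sh' = s_gts sh" "s_free sh' = Suc (s_free sh)"
    by (auto simp: sh'_def)
  show p: "pub sh' = pub sh"
    using q(1) s(2) ne pub_next[of sh] pub_prior[of sh] by (auto simp: pub_def A N split: if_splits)
  show g: "grows sh sh'" by (auto simp: grows_def p A N)
  show "alloced sh b \<Longrightarrow> nd sh' b = nd sh b" "s_gts sh' = s_gts sh" "alloced sh' (s_free sh)"
    "nd sh' (s_free sh) = mknode BOT k v (unm s) q" by (auto simp: A N)
  show "wf_mem sh'"
  proof
    fix b
    show "alloced sh' b = (0 < b \<and> b < s_free sh')" using pos by (auto simp: A alloced_iff)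
    show "good sh' b (ref (nxn sh' b))"
      if b: "alloced sh' b" "tsn sh' b \<noteq> BOT" "ref (nxn sh' b) \<noteq> NULL"
      using b grows_good[OF g] next_good by (auto simp: A N split: if_splits)
    show "prn sh' b < b" if "alloced sh' b" "prn sh' b \<noteq> NULL"
      using prior_less[of b] that al(1)[unfolded alloced_iff] by (auto simp: A N split: if_splits)
    show "b = HEAD" if "alloced sh' b" "kyn sh' b = NegInf"
      using key_NegInf[of b] that k by (auto simp: A N split: if_splits)
    show "kyn sh' b = PosInf" if "alloced sh' b" "ref (nxn sh' b) = NULL"
      using next_NULL[of b] that s by (auto simp: A N split: if_splits)
    show "tsn sh' (prn sh' b) \<noteq> BOT" if "alloced sh' b" "prn sh' b \<noteq> NULL"
      using prior_ts[of b] prior_alloced[of b] that q qN by (auto simp: A N split: if_splits)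
  qed (use s gts_ge in \<open>auto simp: A N head qN BOT_def ne intro: wf_intros dest: wf_dests[unfolded BOT_def] split: if_splits\<close>)
qed

text \<open>The target of the pointer stays the same, so only the two ends of the list need care:
  key \<open>NegInf\<close> is excluded to keep the head unfrozen, and a mark on key
  \<open>PosInf\<close> to keep marked pointers away from NULL.\<close>

lemma bits_wf:
  assumes b: "b \<in> pub sh" "tsn sh b \<noteq> BOT" "kyn sh b \<noteq> NegInf" "\<not> mf (nxn sh b)"
    and p: "ref p = ref (nxn sh b)" "marked p \<Longrightarrow> kyn sh b \<noteq> PosInf"
  defines "sh' \<equiv> setn sh b ((nd sh b)\<lparr>n_next := p\<rparr>)"
  shows "wf_mem sh'" "grows sh sh'" "pub sh' = pub sh" "s_gts sh' = s_gts sh"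
    "kyn sh' c = kyn sh c" "tsn sh' c = tsn sh c" "nxn sh' c = (if c = b then p else nxn sh c)"
proof -
  have al: "alloced sh b" using b pub_alloced by blast
  have A [simp]: "alloced sh' c \<longleftrightarrow> alloced sh c" for c
    using al by (auto simp: sh'_def alloced_setn)
  have N: "nxn sh' c = (if c = b then p else nxn sh c)" for c
    by (auto simp: sh'_def nd_setn)
  have [simp]: "kyn sh' c = kyn sh c" "prn sh' c = prn sh c" "tsn sh' c = tsn sh c" for c
    by (auto simp: sh'_def nd_setn)
  have R [simp]: "ref (nxn sh' c) = ref (nxn sh c)" for c using p by (auto simp: N)
  have [simp]: "s_gts sh' = s_gts sh" "s_free sh' = s_free sh"
    by (auto simp: sh'_def)
  show P: "pub sh' = pub sh" by (simp add: pub_def)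
  show g: "grows sh sh'" using b by (auto simp: grows_def P N)
  show "s_gts sh' = s_gts sh" "kyn sh' c = kyn sh c" "tsn sh' c = tsn sh c"
     "nxn sh' c = (if c = b then p else nxn sh c)" by (auto simp: N)
  show "wf_mem sh'"
  proof
    fix c
    show "mf (nxn sh' c) \<Longrightarrow> tsn sh' c \<noteq> BOT" if "alloced sh' c"
      using that mf_ts b by (auto simp: N split: if_splits)
    show "ref (nxn sh' c) \<noteq> NULL" if "alloced sh' c" "marked (nxn sh' c)"
      using that marked_next p key_PosInf_iff[of b] by (auto simp: N simp del: R split: if_splits)
    show "c = HEAD" if "alloced sh' c" "kyn sh' c = NegInf"
      using key_NegInf[of c] that by simp
    show "\<not> mf (nxn sh' HEAD)" using head b by (auto simp: N)
    show "good sh' c (ref (nxn sh' c))"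
      if b: "alloced sh' c" "tsn sh' c \<noteq> BOT" "ref (nxn sh' c) \<noteq> NULL"
      using b grows_good[OF g] next_good by auto
    show "alloced sh' c \<longleftrightarrow> 0 < c \<and> c < s_free sh'"
      using alloced_iff by simp
  qed (auto simp: head gts_ge intro: wf_intros dest: wf_dests)
qed

text \<open>The old successor is the prior of the new one, so \<open>good_prior\<close> prolongs the
  chain that was good for \<open>p\<close> by one node, whatever the timestamp of
  \<open>new\<close>. The same prior pointer keeps \<open>old\<close> published.\<close>

lemma swing_wf:
  assumes p: "p \<in> pub sh" "tsn sh p \<noteq> BOT" "nxn sh p = unm old" and old: "old \<in> pub sh"
    and new: "alloced sh new" "prn sh new = old" "kyn sh p < kyn sh new"
  defines "sh' \<equiv> setn sh p ((nd sh p)\<lparr>n_next := unm new\<rparr>)"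
  shows "wf_mem sh'" "grows sh sh'" "pub sh' = insert new (pub sh)" "s_gts sh' = s_gts sh"
    "kyn sh' c = kyn sh c" "tsn sh' c = tsn sh c" "nxn sh' c = (if c = p then unm new else nxn sh c)"
proof -
  have al: "alloced sh p" using p pub_alloced by blast
  have A [simp]: "alloced sh' c \<longleftrightarrow> alloced sh c" for c
    using al by (auto simp: sh'_def alloced_setn)
  have N: "nxn sh' c = (if c = p then unm new else nxn sh c)" for c
    by (auto simp: sh'_def nd_setn)
  have [simp]: "kyn sh' c = kyn sh c" "prn sh' c = prn sh c" "tsn sh' c = tsn sh c" for c
    by (auto simp: sh'_def nd_setn)
  have [simp]: "s_gts sh' = s_gts sh" "s_free sh' = s_free sh"
    by (auto simp: sh'_def)
  have newN: "new \<noteq> NULL" and oldN: "old \<noteq> NULL"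
    using new old by (auto simp: alloced_iff NULL_def pub_def HEAD_def)
  show P: "pub sh' = insert new (pub sh)"
  proof (intro equalityI subsetI)
    fix b assume "b \<in> pub sh'"
    then show "b \<in> insert new (pub sh)"
      using pub_next[of sh] pub_prior[of sh] by (auto simp: pub_def N split: if_splits)
  next
    fix b assume "b \<in> insert new (pub sh)"
    then consider "b = HEAD" | "b = new" | "b \<noteq> NULL" "prn sh new = b"
      | c where "b \<noteq> NULL" "alloced sh c" "c \<noteq> p" "ref (nxn sh c) = b"
      | c where "b \<noteq> NULL" "alloced sh c" "prn sh c = b"
      using p(3) new(2) by (auto simp: pub_def) (metis unm_sel(1))
    then show "b \<in> pub sh'"
    proof cases
      case 1
      then show ?thesis by (simp add: pub_def)
    next
      case 2
      then show ?thesis using pub_next[of sh' p] newN al by (simp add: N)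
    next
      case 3
      then show ?thesis using pub_prior[of sh' new] new(1) by simp
    next
      case (4 c)
      then show ?thesis using pub_next[of sh' c] by (simp add: N)
    next
      case (5 c)
      then show ?thesis using pub_prior[of sh' c] by simp
    qed
  qed
  show g: "grows sh sh'" using p by (auto simp: grows_def P N)
  show "s_gts sh' = s_gts sh" "kyn sh' c = kyn sh c" "tsn sh' c = tsn sh c"
     "nxn sh' c = (if c = p then unm new else nxn sh c)" by (auto simp: N)
  show "wf_mem sh'"
  proof
    fix c
    show "c = HEAD" if "alloced sh' c" "kyn sh' c = NegInf"
      using key_NegInf[of c] that by simp
    show "good sh' c (ref (nxn sh' c))"
      if b: "alloced sh' c" "tsn sh' c \<noteq> BOT" "ref (nxn sh' c) \<noteq> NULL"
    proof (cases "c = p")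
      case True
      then have "good sh' c old"
        using grows_good[OF g al p(2)] next_good[OF al p(2)] p oldN by simp
      then show ?thesis using True new by (simp add: N good.good_prior)
    next
      case False
      then show ?thesis using b grows_good[OF g] next_good by (auto simp: N)
    qed
    show "alloced sh' c \<longleftrightarrow> 0 < c \<and> c < s_free sh'"
      using alloced_iff by simp
  qed (use p new newN in \<open>auto simp: N head gts_ge intro: wf_intros dest: wf_dests split: if_splits\<close>)
qed

end

section \<open>Thread invariant\<close>

text \<open>Marked pointers never change, so this property is permanent. Every node that the loop of
  \<open>trim\<close> reaches beyond its victim has it, which limits where flags can be set.\<close>

definition mark_target :: "('k, 'v) shared \<Rightarrow> addr \<Rightarrow> bool" where
  "mark_target sh b \<longleftrightarrow> (\<exists>m\<in>pub sh. marked (nxn sh m) \<and> ref (nxn sh m) = b)"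

fun op_ok :: "('k, 'v) oper option \<Rightarrow> fret \<Rightarrow> 'k ekey \<Rightarrow> bool" where
  "op_ok o' RIns x = (\<exists>k v. o' = Some (OIns k v) \<and> x = Key k)"
| "op_ok o' RRem1 x = (\<exists>k. o' = Some (ORem k) \<and> x = Key k)"
| "op_ok o' RRem2 x = (\<exists>k. o' = Some (ORem k) \<and> x = Key k)"
| "op_ok o' RCon x = (\<exists>k. o' = Some (OCon k) \<and> x = Key k)"
| "op_ok o' RRQ x = ((\<exists>lo hi. o' = Some (ORQ lo hi)) \<and> x \<noteq> NegInf)"

fun fret_ok :: "('k, 'v) shared \<Rightarrow> fret \<Rightarrow> addr \<Rightarrow> nat \<Rightarrow> bool" where
  "fret_ok sh RRem2 b v = (b \<in> pub sh)"
| "fret_ok sh RRQ b v = (2 \<le> v \<and> 3 \<le> s_gts sh)"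
| "fret_ok sh _ b v = True"

definition find_pcs :: "pc set" where
  "find_pcs = {F_retry, F_loop, F_adv, F_ts1, F_ts1c, F_post, F_post2, F_ts2, F_ts2c}"

definition trim_pcs :: "pc set" where
  "trim_pcs = {T_loop, T_ts, T_tsc, T_flag1, T_flag2, T_chk, T_succ, T_sts, T_stsc, T_alloc, T_cas}"

definition scan_pcs :: "pc set" where
  "scan_pcs = {Q_s1, Q_s1ts, Q_s1tsc, Q_s1w, Q_s1wp, Q_s2, Q_s2ts, Q_s2tsc, Q_s2w, Q_s2wp}"

lemmas pcs_def = find_pcs_def trim_pcs_def scan_pcs_def

definition pc_ok :: "('k, 'v) lst \<Rightarrow> bool" where
  "pc_ok l \<longleftrightarrow>
     (l_pc l = Idle \<longleftrightarrow> l_op l = None) \<and> l_pc l \<noteq> Err \<and>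
     (l_pc l \<in> {I_chk, I_cas} \<longrightarrow> l_fret l = RIns) \<and>
     (l_pc l \<in> {R_chk, R_mark1, R_mark2} \<longrightarrow> l_fret l = RRem1) \<and>
     (l_pc l = R_fin \<longrightarrow> l_fret l = RRem2) \<and>
     (l_pc l = C_fin \<longrightarrow> l_fret l = RCon) \<and>
     (l_pc l = Q_a \<longrightarrow> l_fret l = RRQ) \<and>
     (l_pc l \<in> find_pcs \<union> trim_pcs \<union> {T_nts, T_ntsc, I_chk, I_cas, R_chk, R_mark1, R_mark2, R_fin, C_fin, Q_a}
        \<longrightarrow> op_ok (l_op l) (l_fret l) (l_fkey l)) \<and>
     (l_pc l \<in> scan_pcs \<union> {Q_start, Q_w, Q_wp, Q_ts} \<longrightarrow> (\<exists>lo hi. l_op l = Some (ORQ lo hi))) \<and>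
     (l_pc l \<in> {T_flag2, R_mark2} \<longrightarrow> \<not> mf (l_tp l)) \<and>
     (l_pc l \<in> {Q_wp, Q_ts} \<longrightarrow> l_ckey l \<noteq> NegInf)"

text \<open>If the loop of \<open>find\<close> skipped any node, the first skipped one is frozen.
  The victim of the following \<open>trim\<close> is therefore frozen from the start, and the flag
  CAS can only succeed on a different node.\<close>

definition find_ok :: "('k::linorder, 'v) shared \<Rightarrow> ('k, 'v) lst \<Rightarrow> bool" where
  "find_ok sh l \<longleftrightarrow>
     (l_pc l \<in> find_pcs \<union> trim_pcs \<union> {T_nts, T_ntsc, R_fin, Q_a} \<longrightarrow>
        fret_ok sh (l_fret l) (l_saved l) (l_rts l)) \<and>
     (l_pc l \<in> find_pcs - {F_retry} \<union> trim_pcs \<union> {T_nts, T_ntsc, I_chk, I_cas, Q_a} \<longrightarrow>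
        l_pred l \<in> pub sh \<and> kyn sh (l_pred l) < l_fkey l) \<and>
     (l_pc l \<in> {F_post, F_post2, F_ts2, F_ts2c, T_nts, T_ntsc, I_chk, I_cas, Q_a} \<union> trim_pcs \<longrightarrow>
        tsn sh (l_pred l) \<noteq> BOT) \<and>
     (l_pc l \<in> {F_loop, F_ts1, F_ts1c} \<longrightarrow>
        l_curr l \<in> pub sh \<and> ref (l_pnext l) \<in> pub sh \<and> \<not> mf (l_pnext l) \<and>
        kyn sh (l_pred l) < kyn sh (ref (l_pnext l)) \<and>
        (l_curr l \<noteq> ref (l_pnext l) \<longrightarrow> mf (nxn sh (ref (l_pnext l))))) \<and>
     (l_pc l \<in> {F_post2, F_ts2, F_ts2c, I_chk, I_cas, R_chk, R_mark1, R_mark2, C_fin} \<longrightarrow>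
        l_curr l \<in> pub sh) \<and>
     (l_pc l \<in> {F_ts1, F_ts1c, F_ts2, F_ts2c, I_chk, I_cas} \<longrightarrow> l_fkey l \<le> kyn sh (l_curr l)) \<and>
     (l_pc l \<in> {I_chk, I_cas, R_chk, R_mark1, R_mark2} \<longrightarrow> tsn sh (l_curr l) \<noteq> BOT)"

definition trim_ok :: "('k::linorder, 'v) shared \<Rightarrow> ('k, 'v) lst \<Rightarrow> bool" where
  "trim_ok sh l \<longleftrightarrow>
     (l_pc l \<in> trim_pcs \<longrightarrow>
        l_victim l \<in> pub sh \<and> mf (nxn sh (l_victim l)) \<and>
        kyn sh (l_pred l) < kyn sh (l_victim l) \<and>
        l_tcurr l \<in> pub sh \<and> kyn sh (l_victim l) \<le> kyn sh (l_tcurr l) \<and>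
        (l_tcurr l \<noteq> l_victim l \<longrightarrow> mark_target sh (l_tcurr l))) \<and>
     (l_pc l \<in> trim_pcs - {T_loop, T_ts, T_tsc} \<longrightarrow> tsn sh (l_tcurr l) \<noteq> BOT) \<and>
     (l_pc l \<in> {T_succ, T_sts, T_stsc, T_alloc, T_cas} \<longrightarrow> flagged (nxn sh (l_tcurr l))) \<and>
     (l_pc l \<in> {T_sts, T_stsc, T_alloc, T_cas} \<longrightarrow> ref (nxn sh (l_tcurr l)) = l_succ l) \<and>
     (l_pc l \<in> {T_sts, T_stsc} \<longrightarrow> l_succ l \<in> pub sh) \<and>
     (l_pc l \<in> {T_alloc, T_cas} \<longrightarrow> l_succ l \<noteq> NULL \<longrightarrow>
        l_succ l \<in> pub sh \<and> tsn sh (l_succ l) \<noteq> BOT) \<and>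
     (l_pc l = T_cas \<longrightarrow> alloced sh (l_new l) \<and> l_new l \<notin> pub sh \<and> nxn sh (l_new l) = unm (l_succ l) \<and>
        kyn sh (l_new l) = kyn sh (l_tcurr l) \<and> prn sh (l_new l) = l_victim l)"

text \<open>A saved key \<open>NegInf\<close> means that the predecessor is the head, whose
  timestamp 2 is within the bound and whose key is below every lower limit; the query then proceeds
  to its scan. So \<open>find\<close> is repeated only for keys above \<open>NegInf\<close>, as it
  must be in order to have a predecessor strictly below its key.\<close>

definition op_rest_ok :: "('k::linorder, 'v) shared \<Rightarrow> ('k, 'v) lst \<Rightarrow> bool" where
  "op_rest_ok sh l \<longleftrightarrow>
     (l_pc l \<in> {F_ts1c} \<longrightarrow> tsv_ok sh (l_tsv l) (l_pred l)) \<and>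
     (l_pc l \<in> {F_ts2c} \<longrightarrow> tsv_ok sh (l_tsv l) (l_curr l)) \<and>
     (l_pc l \<in> {T_tsc} \<longrightarrow> tsv_ok sh (l_tsv l) (l_tcurr l)) \<and>
     (l_pc l \<in> {T_stsc, Q_s1tsc, Q_s2tsc} \<longrightarrow> tsv_ok sh (l_tsv l) (l_succ l)) \<and>
     (l_pc l \<in> {T_ntsc, I_tsc} \<longrightarrow> tsv_ok sh (l_tsv l) (l_new l)) \<and>
     (l_pc l \<in> {T_nts, T_ntsc, I_ts, I_tsc} \<longrightarrow> l_new l \<in> pub sh) \<and>
     (l_pc l = I_cas \<longrightarrow> alloced sh (l_new l) \<and> l_new l \<notin> pub sh \<and> nxn sh (l_new l) = unm (l_curr l) \<and>
        kyn sh (l_new l) = l_fkey l \<and> prn sh (l_new l) = l_curr l) \<and>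
     (l_pc l \<in> {R_mark1, R_mark2} \<longrightarrow> kyn sh (l_curr l) = l_fkey l) \<and>
     (l_pc l \<in> {Q_w, Q_wp, Q_ts} \<longrightarrow> 3 \<le> s_gts sh) \<and>
     (l_pc l \<in> scan_pcs \<union> {Q_w, Q_wp} \<longrightarrow> 2 \<le> l_rts l) \<and>
     (l_pc l \<in> {Q_w, Q_wp} \<longrightarrow> l_pred l \<in> pub sh \<and> tsn sh (l_pred l) \<noteq> BOT) \<and>
     (l_pc l = Q_w \<longrightarrow> l_ckey l = NegInf \<longrightarrow> l_pred l = HEAD) \<and>
     (l_pc l = Q_wp \<longrightarrow> l_rts l < tsn sh (l_pred l)) \<and>
     (l_pc l \<in> scan_pcs \<longrightarrow>
        l_curr l \<in> pub sh \<and> tsn sh (l_curr l) \<noteq> BOT \<and> tsn sh (l_curr l) \<le> l_rts l) \<and>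
     (l_pc l \<in> scan_pcs - {Q_s1, Q_s2} \<longrightarrow> l_succ l \<in> pub sh \<and> good sh (l_curr l) (l_succ l)) \<and>
     (l_pc l \<in> {Q_s1w, Q_s2w, Q_s1wp, Q_s2wp} \<longrightarrow> tsn sh (l_succ l) \<noteq> BOT) \<and>
     (l_pc l \<in> {Q_s1wp, Q_s2wp} \<longrightarrow> l_rts l < tsn sh (l_succ l))"

definition linv :: "('k::linorder, 'v) shared \<Rightarrow> ('k, 'v) lst \<Rightarrow> bool" where
  "linv sh l \<longleftrightarrow> pc_ok l \<and> find_ok sh l \<and> trim_ok sh l \<and> op_rest_ok sh l"

lemma grows_pub:
  assumes "wf_mem sh" "grows sh sh'" "b \<in> pub sh"
  shows "b \<in> pub sh'" "kyn sh' b = kyn sh b" "tsn sh b \<noteq> BOT \<Longrightarrow> tsn sh' b = tsn sh b"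
    "mf (nxn sh b) \<Longrightarrow> nxn sh' b = nxn sh b" "marked (nxn sh b) \<Longrightarrow> nxn sh' b = nxn sh b"
    "flagged (nxn sh b) \<Longrightarrow> nxn sh' b = nxn sh b"
    "tsv_ok sh v b \<Longrightarrow> tsv_ok sh' v b"
    "tsn sh b \<noteq> BOT \<Longrightarrow> good sh b s \<Longrightarrow> good sh' b s"
proof -
  interpret wf_mem sh by fact
  have al: "alloced sh c" if "c \<in> pub sh" for c using that pub_alloced by blast
  have sub: "c \<in> pub sh \<Longrightarrow> c \<in> pub sh'" for c using assms(2) by (auto simp: grows_def)
  note g = growsD[OF assms(2) al]
  show "b \<in> pub sh'" using assms(3) sub by blast
  show "kyn sh' b = kyn sh b" "tsn sh b \<noteq> BOT \<Longrightarrow> tsn sh' b = tsn sh b"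
    "mf (nxn sh b) \<Longrightarrow> nxn sh' b = nxn sh b" "marked (nxn sh b) \<Longrightarrow> nxn sh' b = nxn sh b"
    "flagged (nxn sh b) \<Longrightarrow> nxn sh' b = nxn sh b"
    using g[OF assms(3)] by (auto simp: mf_def)
  show "good sh' b s" if "tsn sh b \<noteq> BOT" "good sh b s"
    using grows_good[OF assms(2) al[OF assms(3)]] that by blast
  show "tsv_ok sh' v b" if v: "tsv_ok sh v b"
  proof -
    have "tsn sh' (ref (nxn sh' b)) \<le> v" if b: "tsn sh' b = BOT" "ref (nxn sh' b) \<noteq> NULL"
    proof -
      have *: "tsn sh b = BOT" "nxn sh' b = nxn sh b" using g[OF assms(3)] b by auto
      then have "tsn sh (ref (nxn sh b)) \<noteq> BOT" "alloced sh (ref (nxn sh b))"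
        using b next_ts[of b] next_alloced[of b] al assms(3) by auto
      then show ?thesis using * v b growsD(4)[OF assms(2)] by (auto simp: tsv_ok_def)
    qed
    then show ?thesis using v assms(2) by (auto simp: tsv_ok_def grows_def)
  qed
qed

lemma grows_mark_target:
  assumes "wf_mem sh" "grows sh sh'" "mark_target sh b"
  shows "mark_target sh' b"
proof -
  obtain m where m: "m \<in> pub sh" "marked (nxn sh m)" "ref (nxn sh m) = b"
    using assms(3) by (auto simp: mark_target_def)
  then show ?thesis
    using grows_pub(1,5)[OF assms(1,2) m(1)] by (auto simp: mark_target_def intro!: bexI[of _ m])
qed

text \<open>Noninterference. The only assertion that another thread could destroy is that a pending
  node is still unpublished, hence the extra premise.\<close>

lemma linv_grows:
  assumes wf: "wf_mem sh" and g: "grows sh sh'" and l: "linv sh l"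
    and new: "l_pc l \<in> {T_cas, I_cas} \<Longrightarrow> l_new l \<notin> pub sh'"
  shows "linv sh' l"
proof -
  note G = grows_pub[OF wf g]
  have gts: "3 \<le> s_gts sh \<Longrightarrow> 3 \<le> s_gts sh'" using g by (simp add: grows_def)
  have fr: "fret_ok sh r b v \<Longrightarrow> fret_ok sh' r b v" for r b v
    using gts G(1) by (cases r) auto
  have un: "alloced sh' b" "nxn sh' b = nxn sh b" "kyn sh' b = kyn sh b" "prn sh' b = prn sh b"
    if "alloced sh b" "b \<notin> pub sh" for b
    using growsD[OF g] that by auto
  have "find_ok sh l" "trim_ok sh l" "op_rest_ok sh l" using l by (auto simp: linv_def)
  then have "find_ok sh' l \<and> trim_ok sh' l \<and> op_rest_ok sh' l"
    using new unfolding find_ok_def trim_ok_def op_rest_ok_def pcs_def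
    by (cases "l_pc l") (simp_all add: G un gts fr grows_mark_target[OF wf g])
  then show ?thesis using l by (simp add: linv_def)
qed

section \<open>Preservation of the invariants\<close>

lemmas linv_unfolded = linv_def[unfolded pc_ok_def find_ok_def trim_ok_def op_rest_ok_def pcs_def]
lemmas linvD = linv_unfolded[THEN iffD1]

definition local_pcs :: "pc set" where
  "local_pcs = {F_retry, F_loop, F_adv, F_ts1, F_post, F_post2, F_ts2, T_loop, T_ts, T_flag1, T_chk,
     T_succ, T_sts, T_nts, I_ts, R_chk, R_mark1, R_fin, C_fin, Q_a, Q_w, Q_wp, Q_ts,
     Q_s1, Q_s1ts, Q_s1w, Q_s1wp, Q_s2, Q_s2ts, Q_s2w, Q_s2wp}"

lemma op_ok_NegInf [simp]: "\<not> op_ok o' r NegInf"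
  by (cases r) auto

lemma mark_targetI: "b \<in> pub sh \<Longrightarrow> marked (nxn sh b) \<Longrightarrow> mark_target sh (ref (nxn sh b))"
  by (auto simp: mark_target_def)

definition ts_pcs :: "pc set" where
  "ts_pcs = {F_ts1c, F_ts2c, T_tsc, T_stsc, T_ntsc, I_tsc, Q_s1tsc, Q_s2tsc}"

definition ts_target :: "('k, 'v) lst \<Rightarrow> addr" where
  "ts_target l = (case l_pc l of F_ts1c \<Rightarrow> l_pred l | F_ts2c \<Rightarrow> l_curr l | T_tsc \<Rightarrow> l_tcurr l
     | T_ntsc \<Rightarrow> l_new l | I_tsc \<Rightarrow> l_new l | _ \<Rightarrow> l_succ l)"

context wf_mem
begin

lemma head_next: "ref (nxn sh HEAD) \<in> pub sh" "kyn sh (ref (nxn sh HEAD)) \<noteq> NegInf"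
proof -
  show "ref (nxn sh HEAD) \<in> pub sh"
    using next_pub[OF head_pub] head by simp
  then show "kyn sh (ref (nxn sh HEAD)) \<noteq> NegInf"
    using next_key[OF head(1)] head(2) by (metis NULL_notin_pub not_less_NegInf(1))
qed

lemma tsv_ok_gts: "b \<in> pub sh \<Longrightarrow> tsv_ok sh (s_gts sh) b"
  using gts_ge ts_le_gts next_alloced pub_alloced by (auto simp: tsv_ok_def)

lemma next_pub_facts:
  assumes "b \<in> pub sh" "ref (nxn sh b) \<noteq> NULL"
  shows "ref (nxn sh b) \<in> pub sh" "kyn sh b < kyn sh (ref (nxn sh b))"
    "tsn sh b \<noteq> BOT \<Longrightarrow> good sh b (ref (nxn sh b))"
  using assms pub_alloced next_key pub_next next_good by blast+

lemma pub_next_NULL: "b \<in> pub sh \<Longrightarrow> kyn sh b < x \<Longrightarrow> ref (nxn sh b) \<noteq> NULL"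
  using key_PosInf_iff[of b] pub_alloced[of b] by auto

lemma prior_facts:
  assumes "b \<in> pub sh" "2 < tsn sh b"
  shows "prn sh b \<in> pub sh" "tsn sh (prn sh b) \<noteq> BOT" "prn sh b < b" "b \<noteq> HEAD"
  using assms head prior_NULL[of b] pub_prior[of sh b] prior_ts[of b] prior_less[of b] pub_alloced[of b]
  by auto

lemma exec_local:
  assumes l: "linv sh l" and op: "l_op l \<noteq> None" and pc: "l_pc l \<in> local_pcs"
  shows "case exec sh l of (sh', l', a) \<Rightarrow> sh' = sh \<and> linv sh l' \<and> l_pc l' \<notin> {T_cas, I_cas}"
proof -
  note L = linvD[OF l]
  note exec = exec_def goto_def ret_def pub_alloced head
  note inv = linv_unfolded tsv_ok_gts head_pub head head_next next_pub_facts pub_alloced not_le not_less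
    mark_targetI
  have ?thesis if "l_pc l \<in> {F_retry, F_loop, F_ts1, F_post2, F_ts2, T_ts, T_flag1, T_chk, T_succ, T_sts,
     T_nts, I_ts, R_chk, R_mark1, R_fin, C_fin, Q_w, Q_ts, Q_s1ts, Q_s1w, Q_s2ts, Q_s2w}"
    using that L op
    by (elim insertE emptyE)
      ((simp, (elim conjE)?, simp add: exec, (simp add: inv)?, (auto simp: head)?)[1])+
  \<comment> \<open>The predecessor has a key strictly below the searched one, hence not
    \<open>PosInf\<close>, so its next is not NULL.\<close>
  moreover have ?thesis if "l_pc l \<in> {F_adv, F_post}"
    using that L op pub_next_NULL[of "l_pred l" "l_fkey l"]
    by (elim insertE emptyE) (simp, elim conjE, simp add: exec, simp add: inv)+
  moreover have ?thesis if "l_pc l = T_loop"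
    using that L op marked_next[of "l_tcurr l"]
    by (simp, elim conjE, simp add: exec, simp add: inv)
      (auto intro: order.trans[OF _ less_imp_le[OF next_pub_facts(2)]])
  \<comment> \<open>The head is the only node with key \<open>NegInf\<close>, which supplies the
    clause on the saved key.\<close>
  moreover have ?thesis if "l_pc l = Q_a"
    using that L op key_NegInf[of "l_pred l"]
    by (simp, elim conjE, simp add: exec) (auto simp: inv)
  moreover have ?thesis if "l_pc l = Q_wp"
    using that L op prior_facts[of "l_pred l"]
    by (simp, elim conjE, simp add: exec) (auto simp: inv)
  \<comment> \<open>The current node is stamped within the bound and \<open>l_succ\<close> above it,
    so \<open>l_succ\<close> is no stopping point and \<open>good\<close> passes on to its
    prior.\<close>
  moreover have ?thesis if "l_pc l \<in> {Q_s1wp, Q_s2wp}"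
    using that L op prior_facts[of "l_succ l"] good_priorD[of sh "l_curr l" "l_succ l"]
    by (elim insertE emptyE) ((simp, elim conjE, simp add: exec, simp add: inv, auto?)[1])+
  moreover have ?thesis if "l_pc l = Q_s1"
    using that L op pub_next_NULL[of "l_curr l" "rq_lo (l_op l)"]
    by (simp, elim conjE, simp add: exec, simp add: inv)
  moreover have ?thesis if "l_pc l = Q_s2"
    using that L op key_PosInf_iff[of "l_curr l"]
    by (simp, elim conjE, simp add: exec, (simp add: inv)?)
      (auto simp: next_pub_facts pub_alloced rq_hi_def)
  ultimately show ?thesis using pc unfolding local_pcs_def insert_iff by argo
qed

text \<open>The local jump is treated in an arbitrary memory \<open>s\<close>. This separates two
  concerns: noninterference carries the invariant of the old locals to the new memory, and there the
  program location advances, using only that the target is now stamped.\<close>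

lemma exec_ts:
  assumes l: "linv sh l" and op: "l_op l \<noteq> None" and pc: "l_pc l \<in> ts_pcs"
  defines "b \<equiv> ts_target l"
  shows "b \<in> pub sh \<and> tsv_ok sh (l_tsv l) b \<and>
    (case exec sh l of (sh', l', a) \<Rightarrow> sh' = cas_ts sh b (nd sh b) (l_tsv l) \<and> l_pc l' \<notin> {T_cas, I_cas} \<and>
      (\<forall>s. linv s l \<longrightarrow> tsn s b \<noteq> BOT \<longrightarrow> linv s l'))"
  using pc linvD[OF l] op unfolding ts_pcs_def b_def ts_target_def
  by (elim insertE emptyE)
    ((simp, elim conjE, simp add: exec_def goto_def ret_def pub_alloced,
      (intro conjI allI impI; (cases "l_fret l", auto simp: linv_unfolded unm_ref)?)?)[1])+

end

section \<open>Effects of a step on the published nodes\<close>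

text \<open>Clock ticks, timestamp writes, allocations and failing CASes are all quiet.\<close>

definition quiet :: "('k::linorder, 'v) shared \<Rightarrow> ('k, 'v) shared \<Rightarrow> bool" where
  "quiet sh sh' \<longleftrightarrow> pub sh' = pub sh \<and> (\<forall>b\<in>pub sh. nxn sh' b = nxn sh b)"

definition flagging :: "('k::linorder, 'v) shared \<Rightarrow> ('k, 'v) lst \<Rightarrow> ('k, 'v) shared \<Rightarrow> ('k, 'v) lst \<Rightarrow> bool" where
  "flagging sh l sh' l' \<longleftrightarrow> l_pc l = T_flag2 \<and> l_pc l' = T_succ \<and> pub sh' = pub sh \<and>
     \<not> mf (nxn sh (l_tcurr l)) \<and>
     nxn sh' = (nxn sh)(l_tcurr l := setflag (nxn sh (l_tcurr l)))"

definition swinging :: "('k::linorder, 'v) shared \<Rightarrow> ('k, 'v) lst \<Rightarrow> ('k, 'v) shared \<Rightarrow> ('k, 'v) lst \<Rightarrow> bool" where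
  "swinging sh l sh' l' \<longleftrightarrow> l_pc l = T_cas \<and> l_pc l' = T_nts \<and> pub sh' = insert (l_new l) (pub sh) \<and>
     nxn sh (l_pred l) = unm (l_victim l) \<and>
     nxn sh' = (nxn sh)(l_pred l := unm (l_new l))"

definition inserting :: "('k, 'v) lst \<Rightarrow> ('k, 'v) lst \<Rightarrow> bool" where
  "inserting l l' \<longleftrightarrow> l_pc l = I_cas \<and> l_pc l' = I_ts"

definition marking :: "('k, 'v) lst \<Rightarrow> ('k, 'v) lst \<Rightarrow> bool" where
  "marking l l' \<longleftrightarrow> l_pc l = R_mark2 \<and> l_pc l' = F_retry \<and> l_fret l' = RRem2"

text \<open>The clause on \<open>pub\<close> together with the fresh address of a pending node keeps
  the pending nodes of different threads distinct and unpublished. The final disjunction is the case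
  distinction on which the termination argument rests.\<close>

definition step_ok :: "('k::linorder, 'v) shared \<Rightarrow> ('k, 'v) lst \<Rightarrow> ('k, 'v) shared \<Rightarrow> ('k, 'v) lst \<Rightarrow> bool" where
  "step_ok sh l sh' l' \<longleftrightarrow> wf_mem sh' \<and> grows sh sh' \<and> linv sh' l' \<and>
     pub sh' \<subseteq> (if l_pc l \<in> {T_cas, I_cas} then insert (l_new l) (pub sh) else pub sh) \<and>
     (l_pc l' \<in> {T_cas, I_cas} \<longrightarrow> l_new l' = s_free sh) \<and>
     (quiet sh sh' \<or> flagging sh l sh' l' \<or> swinging sh l sh' l' \<or> inserting l l' \<or> marking l l')"

lemma quiet_refl [simp]: "quiet sh sh"
  by (simp add: quiet_def)

section \<open>Verification of the individual steps\<close>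

context wf_mem
begin

lemma step_ok_local:
  assumes "linv sh l" "l_op l \<noteq> None" "l_pc l \<in> local_pcs"
  shows "case exec sh l of (sh', l', a) \<Rightarrow> step_ok sh l sh' l'"
  using exec_local[OF assms] wf_mem_axioms by (auto simp: step_ok_def)

lemma step_ok_ts:
  assumes "linv sh l" "l_op l \<noteq> None" "l_pc l \<in> ts_pcs"
  shows "case exec sh l of (sh', l', a) \<Rightarrow> step_ok sh l sh' l'"
proof -
  obtain sh' l' a where e: "exec sh l = (sh', l', a)" by (cases "exec sh l") auto
  define b where "b = ts_target l"
  have b: "b \<in> pub sh" "tsv_ok sh (l_tsv l) b" and sh': "sh' = cas_ts sh b (nd sh b) (l_tsv l)"
    and l': "l_pc l' \<notin> {T_cas, I_cas}" "\<And>s. linv s l \<Longrightarrow> tsn s b \<noteq> BOT \<Longrightarrow> linv s l'"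
    using exec_ts[OF assms] e by (auto simp: b_def)
  note c = cas_ts_wf[OF b, folded sh']
  have "l_pc l \<notin> {T_cas, I_cas}" using assms(3) by (auto simp: ts_pcs_def)
  then have "linv sh' l" using linv_grows[OF wf_mem_axioms c(2) assms(1)] by auto
  then show ?thesis using c l' by (simp add: e step_ok_def quiet_def subset_insertI)
qed

lemma step_ok_Q_start:
  assumes "linv sh l" "l_op l \<noteq> None" "l_pc l = Q_start"
  shows "case exec sh l of (sh', l', a) \<Rightarrow> step_ok sh l sh' l'"
proof -
  have "\<exists>lo hi. l_op l = Some (ORQ lo hi)" using linvD[OF assms(1)] assms(3) by simp
  then show ?thesis
    using tick gts_ge
    by (auto simp: exec_def assms(3) step_ok_def quiet_def linv_unfolded rq_lo_def)
qed

lemma trim_nodeD: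
  assumes "linv sh l" "l_pc l \<in> {T_alloc, T_cas}"
  shows "l_victim l \<in> pub sh" "tsn sh (l_victim l) \<noteq> BOT" "kyn sh (l_tcurr l) \<noteq> NegInf"
    "l_tcurr l \<in> pub sh" "l_succ l = NULL \<longleftrightarrow> kyn sh (l_tcurr l) = PosInf"
    "l_succ l \<noteq> NULL \<Longrightarrow> l_succ l \<in> pub sh \<and> kyn sh (l_tcurr l) < kyn sh (l_succ l) \<and> tsn sh (l_succ l) \<noteq> BOT"
    "l_pred l \<in> pub sh" "tsn sh (l_pred l) \<noteq> BOT" "kyn sh (l_pred l) < kyn sh (l_tcurr l)"
proof -
  have v: "l_victim l \<in> pub sh" "mf (nxn sh (l_victim l))" "kyn sh (l_pred l) < kyn sh (l_victim l)"
     and c: "l_tcurr l \<in> pub sh" "kyn sh (l_victim l) \<le> kyn sh (l_tcurr l)"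
    and s: "ref (nxn sh (l_tcurr l)) = l_succ l" "l_succ l \<noteq> NULL \<Longrightarrow> l_succ l \<in> pub sh \<and> tsn sh (l_succ l) \<noteq> BOT"
    and p: "l_pred l \<in> pub sh" "tsn sh (l_pred l) \<noteq> BOT"
    using assms by (auto simp: linv_def trim_ok_def find_ok_def pcs_def)
  show "l_victim l \<in> pub sh" "tsn sh (l_victim l) \<noteq> BOT"  "l_tcurr l \<in> pub sh"
    "l_pred l \<in> pub sh" "tsn sh (l_pred l) \<noteq> BOT"
    using v p c(1) mf_ts pub_alloced by auto
  show "kyn sh (l_pred l) < kyn sh (l_tcurr l)" using v c by simp
  then show "kyn sh (l_tcurr l) \<noteq> NegInf" by auto
  show "l_succ l = NULL \<longleftrightarrow> kyn sh (l_tcurr l) = PosInf"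
    using key_PosInf_iff[OF pub_alloced[OF c(1)]] s by simp
  show "l_succ l \<noteq> NULL \<Longrightarrow> l_succ l \<in> pub sh \<and> kyn sh (l_tcurr l) < kyn sh (l_succ l) \<and> tsn sh (l_succ l) \<noteq> BOT"
    using s next_pub_facts[OF c(1)] by auto
qed

lemma step_ok_T_alloc:
  assumes l: "linv sh l" and op: "l_op l \<noteq> None" and pc: "l_pc l = T_alloc"
  shows "case exec sh l of (sh', l', a) \<Rightarrow> step_ok sh l sh' l'"
proof -
  define sh' where "sh' = alloc_sh sh (mknode BOT (kyn sh (l_tcurr l)) (n_val (nd sh (l_tcurr l)))
    (unm (l_succ l)) (l_victim l))"
  have t: "l_pc l \<in> {T_alloc, T_cas}" using pc by simp
  note T = trim_nodeD[OF l t]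
  note A = alloc_wf[OF T(1,2,3,5,6), where v="n_val (nd sh (l_tcurr l))", folded sh'_def, simplified]
  have e: "exec sh l = (sh', l\<lparr>l_new := s_free sh, l_pc := T_cas\<rparr>, AInt)"
    using T(4) pub_alloced by (simp add: exec_def pc sh'_def)
  have "linv sh' l" using linv_grows[OF wf_mem_axioms A(2) l] pc by simp
  then have "linv sh' (l\<lparr>l_new := s_free sh, l_pc := T_cas\<rparr>)"
    using A(3,6,7) A(4)[OF pub_alloced[OF T(4)]] free_notin_pub pc by (simp add: linv_unfolded)
  then show ?thesis
    using A(1-4) pub_alloced by (simp add: e step_ok_def quiet_def pc)
qed

lemma step_ok_I_chk:
  assumes l: "linv sh l" and op: "l_op l \<noteq> None" and pc: "l_pc l = I_chk"
  shows "case exec sh l of (sh', l', a) \<Rightarrow> step_ok sh l sh' l'"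
proof -
  obtain k v where k: "l_op l = Some (OIns k v)" "l_fkey l = Key k"
    and c: "l_curr l \<in> pub sh" "tsn sh (l_curr l) \<noteq> BOT" "Key k \<le> kyn sh (l_curr l)"
    using linvD[OF l] pc by auto
  have al: "alloced sh (l_curr l)" using c pub_alloced by simp
  show ?thesis
  proof (cases "kyn sh (l_curr l) = Key k")
    case True
    have "linv sh (l\<lparr>l_op := None, l_pc := Idle\<rparr>)" by (simp add: linv_unfolded)
    then show ?thesis
      using True al wf_mem_axioms by (simp add: exec_def pc k ret_def step_ok_def)
  next
    case False
    define sh' where "sh' = alloc_sh sh (mknode BOT (Key k) v (unm (l_curr l)) (l_curr l))"
    have 1: "Key k \<noteq> NegInf" "l_curr l = NULL \<longleftrightarrow> Key k = PosInf"
      "l_curr l \<noteq> NULL \<Longrightarrow> l_curr l \<in> pub sh \<and> Key k < kyn sh (l_curr l) \<and> tsn sh (l_curr l) \<noteq> BOT"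
      using c False by (auto simp: order_less_le)
    note A = alloc_wf[OF c(1,2) 1, where v=v, folded sh'_def, simplified]
    have e: "exec sh l = (sh', l\<lparr>l_new := s_free sh, l_pc := I_cas\<rparr>, AInt)"
      using False al by (simp add: exec_def pc sh'_def k)
    have "linv sh' l" using linv_grows[OF wf_mem_axioms A(2) l] pc by simp
    then have "linv sh' (l\<lparr>l_new := s_free sh, l_pc := I_cas\<rparr>)"
      using A(3,6,7) A(4)[OF al] free_notin_pub pc k by (simp add: linv_unfolded)
    then show ?thesis
      using A(1-4) pub_alloced by (simp add: e step_ok_def quiet_def pc)
  qed
qed

lemma step_ok_T_flag2:
  assumes l: "linv sh l" and op: "l_op l \<noteq> None" and pc: "l_pc l = T_flag2"
  shows "case exec sh l of (sh', l', a) \<Rightarrow> step_ok sh l sh' l'"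
proof -
  have c: "l_tcurr l \<in> pub sh" "tsn sh (l_tcurr l) \<noteq> BOT" "\<not> mf (l_tp l)"
    "kyn sh (l_pred l) < kyn sh (l_victim l)" "kyn sh (l_victim l) \<le> kyn sh (l_tcurr l)"
    using linvD[OF l] pc by auto
  have k: "kyn sh (l_tcurr l) \<noteq> NegInf" using order.strict_trans2[OF c(4,5)] by auto
  have al: "alloced sh (l_tcurr l)" using c pub_alloced by simp
  show ?thesis
  proof (cases "nxn sh (l_tcurr l) = l_tp l")
    case True
    define sh' where "sh' = setn sh (l_tcurr l) ((nd sh (l_tcurr l))\<lparr>n_next := setflag (l_tp l)\<rparr>)"
    have 1: "\<not> mf (nxn sh (l_tcurr l))" "ref (setflag (l_tp l)) = ref (nxn sh (l_tcurr l))"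
      "marked (setflag (l_tp l)) \<Longrightarrow> kyn sh (l_tcurr l) \<noteq> PosInf"
      using True c by (auto simp: mf_def)
    note B = bits_wf[OF c(1,2) k 1, folded sh'_def]
    have e: "exec sh l = (sh', l\<lparr>l_pc := T_succ\<rparr>, AInt)"
      using True al by (simp add: exec_def pc sh'_def)
    have "linv sh' l" using linv_grows[OF wf_mem_axioms B(2) l] pc by simp
    then have "linv sh' (l\<lparr>l_pc := T_succ\<rparr>)"
      using B(7) pc by (simp add: linv_unfolded)
    then show ?thesis
      using True c B by (auto simp: e pc step_ok_def flagging_def)
  next
    case False
    have "linv sh (l\<lparr>l_pc := T_chk\<rparr>)"
      using linvD[OF l] pc by (simp add: linv_unfolded)
    then show ?thesis
      using False wf_mem_axioms by (simp add: exec_def pc al goto_def step_ok_def subset_insertI)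
  qed
qed

lemma step_ok_R_mark2:
  assumes l: "linv sh l" and op: "l_op l \<noteq> None" and pc: "l_pc l = R_mark2"
  shows "case exec sh l of (sh', l', a) \<Rightarrow> step_ok sh l sh' l'"
proof -
  obtain k where c: "l_curr l \<in> pub sh" "tsn sh (l_curr l) \<noteq> BOT" "\<not> mf (l_tp l)"
    "kyn sh (l_curr l) = Key k" and k: "l_op l = Some (ORem k)" "l_fkey l = Key k"
    using linvD[OF l] pc by auto
  have al: "alloced sh (l_curr l)" using c pub_alloced by simp
  show ?thesis
  proof (cases "nxn sh (l_curr l) = l_tp l")
    case True
    define sh' where "sh' = setn sh (l_curr l) ((nd sh (l_curr l))\<lparr>n_next := setmark (l_tp l)\<rparr>)"
    have 1: "kyn sh (l_curr l) \<noteq> NegInf" "\<not> mf (nxn sh (l_curr l))"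
      "ref (setmark (l_tp l)) = ref (nxn sh (l_curr l))"
      "marked (setmark (l_tp l)) \<Longrightarrow> kyn sh (l_curr l) \<noteq> PosInf"
      using True c by auto
    note B = bits_wf[OF c(1,2) 1, folded sh'_def]
    have e: "exec sh l = (sh', l\<lparr>l_saved := l_curr l, l_fret := RRem2, l_pc := F_retry\<rparr>, AInt)"
      using True al by (simp add: exec_def pc sh'_def)
    have "linv sh' (l\<lparr>l_saved := l_curr l, l_fret := RRem2, l_pc := F_retry\<rparr>)"
      using B(3) c k by (simp add: linv_unfolded)
    then show ?thesis
      using B by (simp add: e pc step_ok_def marking_def)
  next
    case False
    have "linv sh (l\<lparr>l_fret := RRem1, l_pc := F_retry\<rparr>)"
      using k by (simp add: linv_unfolded)
    then show ?thesis
      using False wf_mem_axioms by (simp add: exec_def pc al goto_def step_ok_def subset_insertI)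
  qed
qed

lemma step_ok_T_cas:
  assumes l: "linv sh l" and op: "l_op l \<noteq> None" and pc: "l_pc l = T_cas"
  shows "case exec sh l of (sh', l', a) \<Rightarrow> step_ok sh l sh' l'"
proof -
  have t: "l_pc l \<in> {T_alloc, T_cas}" using pc by simp
  note T = trim_nodeD[OF l t]
  have n: "alloced sh (l_new l)" "prn sh (l_new l) = l_victim l" "kyn sh (l_pred l) < kyn sh (l_new l)"
    and f: "op_ok (l_op l) (l_fret l) (l_fkey l)" "fret_ok sh (l_fret l) (l_saved l) (l_rts l)"
      "kyn sh (l_pred l) < l_fkey l"
    using linvD[OF l] pc T(9) by simp_all
  have al: "alloced sh (l_pred l)" using T pub_alloced by simp
  show ?thesis
  proof (cases "nxn sh (l_pred l) = unm (l_victim l)")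
    case True
    define sh' where "sh' = setn sh (l_pred l) ((nd sh (l_pred l))\<lparr>n_next := unm (l_new l)\<rparr>)"
    note B = swing_wf[OF T(7,8) True T(1) n, folded sh'_def]
    have e: "exec sh l = (sh', l\<lparr>l_pc := T_nts\<rparr>, AInt)"
      using True al by (simp add: exec_def pc sh'_def)
    have "fret_ok sh' (l_fret l) (l_saved l) (l_rts l)" using f(2) B(3,4) by (cases "l_fret l") auto
    then have "linv sh' (l\<lparr>l_pc := T_nts\<rparr>)"
      using B f op T(7,8) by (simp add: linv_unfolded)
    then show ?thesis
      using True B by (auto simp: e pc step_ok_def swinging_def)
  next
    case False
    have "linv sh (l\<lparr>l_pc := F_retry\<rparr>)"
      using f op by (simp add: linv_unfolded)
    then show ?thesis
      using False wf_mem_axioms by (simp add: exec_def pc al goto_def step_ok_def subset_insertI)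
  qed
qed

lemma step_ok_I_cas:
  assumes l: "linv sh l" and op: "l_op l \<noteq> None" and pc: "l_pc l = I_cas"
  shows "case exec sh l of (sh', l', a) \<Rightarrow> step_ok sh l sh' l'"
proof -
  have n: "alloced sh (l_new l)" "prn sh (l_new l) = l_curr l" "kyn sh (l_pred l) < kyn sh (l_new l)"
    and p: "l_pred l \<in> pub sh" "tsn sh (l_pred l) \<noteq> BOT" "l_curr l \<in> pub sh"
    and f: "op_ok (l_op l) RIns (l_fkey l)"
    using linvD[OF l] pc by auto
  have al: "alloced sh (l_pred l)" using p pub_alloced by simp
  show ?thesis
  proof (cases "nxn sh (l_pred l) = unm (l_curr l)")
    case True
    define sh' where "sh' = setn sh (l_pred l) ((nd sh (l_pred l))\<lparr>n_next := unm (l_new l)\<rparr>)"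
    note B = swing_wf[OF p(1,2) True p(3) n, folded sh'_def]
    have e: "exec sh l = (sh', l\<lparr>l_pc := I_ts\<rparr>, AInt)"
      using True al by (simp add: exec_def pc sh'_def)
    have "linv sh' (l\<lparr>l_pc := I_ts\<rparr>)"
      using B op by (simp add: linv_unfolded)
    then show ?thesis
      using B by (simp add: e pc step_ok_def inserting_def)
  next
    case False
    have "linv sh (l\<lparr>l_fret := RIns, l_pc := F_retry\<rparr>)"
      using f op by (simp add: linv_unfolded)
    then show ?thesis
      using False wf_mem_axioms by (simp add: exec_def pc al goto_def step_ok_def subset_insertI)
  qed
qed

lemma exec_step_ok:
  assumes "linv sh l" "l_op l \<noteq> None" "exec sh l = (sh', l', a)"
  shows "step_ok sh l sh' l'"
proof -
  have "l_pc l \<noteq> Idle" "l_pc l \<noteq> Err" using assms by (auto simp: linv_def pc_ok_def)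
  then consider "l_pc l \<in> local_pcs" | "l_pc l \<in> ts_pcs"
    | "l_pc l = Q_start" | "l_pc l = T_alloc" | "l_pc l = I_chk" | "l_pc l = T_flag2"
    | "l_pc l = R_mark2" | "l_pc l = T_cas" | "l_pc l = I_cas"
    by (cases "l_pc l") (auto simp: local_pcs_def ts_pcs_def)
  then show ?thesis
    using assms step_ok_local step_ok_ts step_ok_Q_start step_ok_T_alloc step_ok_I_chk step_ok_T_flag2
      step_ok_R_mark2 step_ok_T_cas step_ok_I_cas
    by cases fastforce+
qed

end

section \<open>Progress of a thread while the published nodes do not change\<close>

text \<open>The default value outside the published set makes a quiet step preserve this map as a
  function, so the measure can be transported by rewriting. The same holds for
  \<open>vky\<close>.\<close>

definition vnx :: "('k, 'v) shared \<Rightarrow> addr \<Rightarrow> ptr" where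
  "vnx sh b = (if b \<in> pub sh then nxn sh b else unm NULL)"

definition vky :: "('k, 'v) shared \<Rightarrow> addr \<Rightarrow> 'k ekey" where
  "vky sh b = (if b \<in> pub sh then kyn sh b else NegInf)"

definition keys_above :: "('k::linorder, 'v) shared \<Rightarrow> addr \<Rightarrow> nat" where
  "keys_above sh a = card {b \<in> pub sh. vky sh a < vky sh b}"

definition keys_below :: "('k::linorder, 'v) shared \<Rightarrow> 'k ekey \<Rightarrow> nat" where
  "keys_below sh k = card {b \<in> pub sh. vky sh b < k}"

text \<open>The locals agree with the published nodes; as long as these do not change, a thread that
  is fresh never retries, and every other thread becomes fresh with its next retry.\<close>

definition fresh :: "('k::linorder, 'v) shared \<Rightarrow> ('k, 'v) lst \<Rightarrow> bool" where
  "fresh sh l \<longleftrightarrow>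
     l_pc l \<notin> {F_post, F_post2, T_nts, T_ntsc} \<and>
     (l_pc l \<in> {F_loop, F_ts1, F_ts1c} \<longrightarrow> vnx sh (l_pred l) = l_pnext l) \<and>
     (l_pc l = F_adv \<longrightarrow> \<not> mf (vnx sh (l_pred l))) \<and>
     (l_pc l \<in> trim_pcs \<longrightarrow> vnx sh (l_pred l) = unm (l_victim l)) \<and>
     (l_pc l \<in> {T_ts, T_tsc, T_flag1} \<longrightarrow> \<not> marked (vnx sh (l_tcurr l))) \<and>
     (l_pc l = T_flag2 \<longrightarrow> vnx sh (l_tcurr l) = l_tp l) \<and>
     (l_pc l = T_chk \<longrightarrow> flagged (vnx sh (l_tcurr l))) \<and>
     (l_pc l \<in> {F_ts2, F_ts2c, I_chk, I_cas} \<longrightarrow> vnx sh (l_pred l) = unm (l_curr l)) \<and>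
     (l_pc l \<in> {F_ts1, F_ts1c, F_ts2, F_ts2c, R_chk} \<longrightarrow>
        mf (vnx sh (l_curr l)) \<longrightarrow> ref (vnx sh (l_curr l)) = NULL) \<and>
     (l_pc l = R_mark1 \<longrightarrow> \<not> mf (vnx sh (l_curr l))) \<and>
     (l_pc l = R_mark2 \<longrightarrow> vnx sh (l_curr l) = l_tp l)"

text \<open>A range query only repeats find with a strictly smaller key.\<close>

definition find_budget :: "('k::linorder, 'v) shared \<Rightarrow> ('k, 'v) lst \<Rightarrow> nat" where
  "find_budget sh l =
     (if l_pc l = Q_start then card (pub sh) + 2
      else if l_pc l \<in> scan_pcs then 0
      else if l_pc l \<in> {Q_w, Q_wp, Q_ts} then Suc (keys_below sh (l_ckey l))
      else Suc (keys_below sh (l_fkey l)))"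

text \<open>In a quiet step only a thread that is not fresh can fall back to \<open>F_retry\<close>,
  and there it is fresh: 2 drops to 1. The larger values make the renewed \<open>find\<close> of a
  range query a descent as well; the rise to 4 on entering \<open>Q_w\<close> is paid for by
  \<open>find_budget\<close>.\<close>

definition phase :: "('k::linorder, 'v) shared \<Rightarrow> ('k, 'v) lst \<Rightarrow> nat" where
  "phase sh l =
     (if l_pc l \<in> {Q_w, Q_wp} then 4 else if l_pc l = Q_ts then 3 else if fresh sh l then 1 else 2)"

text \<open>Locations that form a loop share a rank: \<open>F_loop\<close> with
  \<open>F_adv\<close>, \<open>Q_w\<close> with \<open>Q_wp\<close>, and the five locations of each
  scan. These loops are left to the later components.\<close>

fun pc_rank :: "pc \<Rightarrow> nat" where
  "pc_rank F_retry = 30"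
| "pc_rank F_loop = 29" | "pc_rank F_adv = 29"
| "pc_rank F_ts1 = 28" | "pc_rank F_ts1c = 27"
| "pc_rank T_loop = 26" | "pc_rank T_ts = 25" | "pc_rank T_tsc = 24" | "pc_rank T_flag1 = 23"
| "pc_rank T_flag2 = 22" | "pc_rank T_chk = 21" | "pc_rank T_succ = 20" | "pc_rank T_sts = 19"
| "pc_rank T_stsc = 18" | "pc_rank T_alloc = 17" | "pc_rank T_cas = 16" | "pc_rank T_nts = 15"
| "pc_rank T_ntsc = 14" | "pc_rank F_post = 13" | "pc_rank F_post2 = 12" | "pc_rank F_ts2 = 11"
| "pc_rank F_ts2c = 10"
| "pc_rank I_chk = 9" | "pc_rank R_chk = 9" | "pc_rank R_fin = 9" | "pc_rank C_fin = 9"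
| "pc_rank Q_a = 9"
| "pc_rank I_cas = 8" | "pc_rank R_mark1 = 8" | "pc_rank I_ts = 7" | "pc_rank R_mark2 = 7"
| "pc_rank I_tsc = 6"
| "pc_rank Q_s1 = 4" | "pc_rank Q_s1ts = 4" | "pc_rank Q_s1tsc = 4" | "pc_rank Q_s1w = 4"
| "pc_rank Q_s1wp = 4"
| "pc_rank _ = 3"

text \<open>Doubling lets two locations alternate: going from \<open>F_loop\<close> to
  \<open>F_adv\<close> at the same node gives up the offset 1, and going on to a larger key loses at
  least 2 before the offset returns. \<open>Q_w\<close> and \<open>Q_wp\<close> alternate in the
  same way, with addresses instead of keys.\<close>

definition walk_rank :: "('k::linorder, 'v) shared \<Rightarrow> ('k, 'v) lst \<Rightarrow> nat" where
  "walk_rank sh l = (case l_pc l of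
      F_loop \<Rightarrow> Suc (2 * keys_above sh (l_curr l)) | F_adv \<Rightarrow> 2 * keys_above sh (l_pred l)
    | T_loop \<Rightarrow> keys_above sh (l_tcurr l)
    | Q_w \<Rightarrow> Suc (2 * l_pred l) | Q_wp \<Rightarrow> 2 * l_pred l
    | _ \<Rightarrow> if l_pc l \<in> scan_pcs then keys_above sh (l_curr l) else 0)"

fun scan_rank :: "pc \<Rightarrow> nat" where
  "scan_rank Q_s1 = 3" | "scan_rank Q_s1ts = 2" | "scan_rank Q_s1tsc = 1"
| "scan_rank Q_s2 = 3" | "scan_rank Q_s2ts = 2" | "scan_rank Q_s2tsc = 1"
| "scan_rank _ = 0"

definition prior_rank :: "('k::linorder, 'v) lst \<Rightarrow> nat" where
  "prior_rank l = (if l_pc l \<in> {Q_s1w, Q_s2w} then Suc (2 * l_succ l)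
     else if l_pc l \<in> {Q_s1wp, Q_s2wp} then 2 * l_succ l else 0)"

definition progress :: "('k::linorder, 'v) shared \<Rightarrow> ('k, 'v) lst \<Rightarrow> nat \<times> nat \<times> nat \<times> nat \<times> nat \<times> nat" where
  "progress sh l = (find_budget sh l, phase sh l, pc_rank (l_pc l), walk_rank sh l,
     scan_rank (l_pc l), prior_rank l)"

definition progress_rel :: "(nat \<times> nat \<times> nat \<times> nat \<times> nat \<times> nat) rel" where
  "progress_rel = less_than <*lex*> less_than <*lex*> less_than <*lex*> less_than <*lex*> less_than <*lex*> less_than"

lemma wf_progress_rel: "wf progress_rel"
  by (auto simp: progress_rel_def)

lemmas progress_defs = progress_def progress_rel_def find_budget_def phase_def walk_rank_def
  prior_rank_def fresh_def scan_pcs_def trim_pcs_def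

lemma vnx_pub: "b \<in> pub sh \<Longrightarrow> vnx sh b = nxn sh b"
  by (simp add: vnx_def)

lemma quiet_setn: "quiet sh (setn sh b n) \<Longrightarrow> b \<in> pub sh \<Longrightarrow> n_next n = nxn sh b"
  by (auto simp: quiet_def nd_setn split: if_splits)

context wf_mem
begin

lemma keys_above_less:
  "a \<in> pub sh \<Longrightarrow> b \<in> pub sh \<Longrightarrow> kyn sh a < kyn sh b \<Longrightarrow> keys_above sh b < keys_above sh a"
  unfolding keys_above_def using finite_pub by (intro psubset_card_mono) (auto simp: vky_def)

lemma keys_below_less: "b \<in> pub sh \<Longrightarrow> kyn sh b < k \<Longrightarrow> keys_below sh (kyn sh b) < keys_below sh k"
  unfolding keys_below_def using finite_pub by (intro psubset_card_mono) (auto simp: vky_def)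

lemma keys_below_le: "keys_below sh k < Suc (card (pub sh))"
  unfolding keys_below_def less_Suc_eq_le using finite_pub by (intro card_mono) auto

text \<open>The critical locations are the pointer CASes. Failure happens only to a thread that is
  not fresh, whose retry lowers the phase. Success in \<open>T_cas\<close> or \<open>R_mark2\<close>
  would not lower the measure, but it alters a published pointer and so contradicts
  quietness.\<close>

lemma quiet_step_progress:
  assumes l: "linv sh l" and op: "l_op l \<noteq> None"
  shows "case exec sh l of (sh', l', a) \<Rightarrow>
    quiet sh sh' \<longrightarrow> a \<noteq> ARet \<longrightarrow> (progress sh l', progress sh l) \<in> progress_rel"
proof -
  note L = linvD[OF l]
  note exec = exec_def goto_def ret_def pub_alloced head
  note prog = progress_defs vnx_pub pub_alloced next_pub_facts head_pub keys_above_less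
  have ?thesis if "l_pc l \<in> {F_retry, F_ts1, F_post, F_post2, F_ts2, T_ts, T_tsc, T_flag2, T_chk, T_succ,
      T_sts, T_stsc, T_alloc, T_nts, T_ntsc, I_cas, I_ts, I_tsc, R_mark1, R_fin, C_fin, Q_w, Q_ts,
      Q_s1, Q_s1ts, Q_s1tsc, Q_s2, Q_s2ts, Q_s2tsc}"
    using that L op
    by (elim insertE emptyE)
      ((simp, (elim conjE)?, simp add: exec, (simp add: prog)?, (auto simp: next_pub_facts)?)[1])+
  \<comment> \<open>\<open>find\<close> may end at a frozen node whose next is NULL. A removal does
    not go on to mark it: there the key is proper, so next is not NULL and the node is
    unfrozen.\<close>
  moreover have ?thesis if "l_pc l \<in> {F_loop, R_chk}"
    using that L op key_PosInf_iff[of "l_curr l"]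
    by (elim insertE emptyE)
      ((simp, elim conjE, simp add: exec, (simp add: prog)?,
        (auto simp: next_pub_facts pub_alloced keys_above_less)?)[1])+
  moreover have ?thesis if "l_pc l = F_adv"
    using that L op pub_next_NULL[of "l_pred l" "l_fkey l"]
    by (simp, elim conjE, simp add: exec, simp add: prog)
      (use keys_above_less[of "l_pred l" "ref (nxn sh (l_pred l))"] in \<open>auto simp: next_pub_facts\<close>)
  moreover have ?thesis if "l_pc l = F_ts1c"
    using that L op unm_ref[of "l_pnext l"]
    by (simp, elim conjE, simp add: exec, simp add: prog)
  moreover have ?thesis if "l_pc l = F_ts2c"
    using that L op
    by (simp, elim conjE, simp add: exec, cases "l_fret l") (simp_all add: prog)
  moreover have ?thesis if "l_pc l = T_loop"
    using that L op marked_next[of "l_tcurr l"]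
    by (simp, elim conjE, simp add: exec, simp add: prog)
  moreover have ?thesis if "l_pc l = T_flag1"
    using that L op
    by (simp, elim conjE, simp add: exec, simp add: prog) (auto simp: mf_def)
  \<comment> \<open>A quiet success would make the unpublished \<open>l_new\<close> equal to the
    published victim.\<close>
  moreover have ?thesis if "l_pc l = T_cas"
    using that L op quiet_setn[of sh "l_pred l" "(nd sh (l_pred l))\<lparr>n_next := unm (l_new l)\<rparr>"]
    by (simp, elim conjE, simp add: exec, simp add: prog) auto
  moreover have ?thesis if pc: "l_pc l = I_chk"
  proof -
    obtain k v where "l_op l = Some (OIns k v)" "l_fkey l = Key k"
      "l_curr l \<in> pub sh" "l_pred l \<in> pub sh"
      using L pc by auto
    then show ?thesis by (simp add: exec pc, simp add: prog pc)
  qed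
  \<comment> \<open>A quiet success would make an unmarked pointer equal to its marked
    version.\<close>
  moreover have ?thesis if "l_pc l = R_mark2"
    using that L op quiet_setn[of sh "l_curr l" "(nd sh (l_curr l))\<lparr>n_next := setmark (l_tp l)\<rparr>"]
    by (simp, elim conjE, simp add: exec, simp add: prog) (metis setmark_sel(3))
  \<comment> \<open>The budget \<open>card (pub sh) + 2\<close> exceeds
    \<open>Suc (keys_below sh k)\<close> for every key.\<close>
  moreover have ?thesis if "l_pc l = Q_start"
    using that L op keys_below_le[of "rq_lo (l_op l)"]
    by (simp, elim conjE, simp add: exec, simp add: prog)
  \<comment> \<open>The predecessor lies strictly below the searched key and is itself published, so
    it is no longer counted once its key becomes the limit.\<close>
  moreover have ?thesis if "l_pc l = Q_a"
    using that L op keys_below_less[of "l_pred l" "l_fkey l"]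
    by (simp, elim conjE, simp add: exec, simp add: prog)
  moreover have ?thesis if "l_pc l = Q_wp"
    using that L op prior_facts[of "l_pred l"]
    by (simp, elim conjE, simp add: exec, simp add: prog)
  \<comment> \<open>When the walk along priors ends, \<open>good\<close> still guarantees a strictly
    larger key than that of the current node.\<close>
  moreover have ?thesis if "l_pc l \<in> {Q_s1w, Q_s2w}"
    using that L op good_key[of sh "l_curr l" "l_succ l"]
    by (elim insertE emptyE) ((simp, elim conjE, simp add: exec, simp add: prog, auto?)[1])+
  moreover have ?thesis if "l_pc l \<in> {Q_s1wp, Q_s2wp}"
    using that L op prior_facts[of "l_succ l"]
    by (elim insertE emptyE) ((simp, elim conjE, simp add: exec, simp add: prog)[1])+
  moreover have "l_pc l \<noteq> Idle" "l_pc l \<noteq> Err" using l op by (auto simp: linv_def pc_ok_def)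
  ultimately show ?thesis by (cases "l_pc l") simp_all
qed

end

section \<open>Lock-freedom\<close>

text \<open>\<open>progress\<close> reads the memory only through \<open>pub\<close>,
  \<open>vnx\<close> and \<open>vky\<close>, and priors never change the keys compared; hence quiet
  steps of other threads leave it alone.\<close>

lemma quiet_progress:
  assumes "wf_mem sh" "grows sh sh'" "quiet sh sh'"
  shows "progress sh' l = progress sh l"
proof -
  have p: "pub sh' = pub sh" using assms(3) by (simp add: quiet_def)
  have v: "vnx sh' = vnx sh" "vky sh' = vky sh"
    using assms(3) grows_pub(2)[OF assms(1,2)] by (auto simp: quiet_def vnx_def vky_def)
  have "keys_above sh' = keys_above sh" "keys_below sh' = keys_below sh" "fresh sh' l = fresh sh l"
    by (simp_all only: keys_above_def[abs_def] keys_below_def[abs_def] fresh_def p v)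
  then show ?thesis by (simp only: progress_def find_budget_def phase_def walk_rank_def p)
qed

text \<open>By the thread invariant these are the only nodes on which the flag CAS of
  \<open>trim\<close> can succeed. Once marking and inserting have ceased, the set cannot
  grow.\<close>

definition trimmable :: "('k, 'v) shared \<Rightarrow> addr set" where
  "trimmable sh = {b \<in> pub sh. \<not> mf (nxn sh b) \<and> mark_target sh b}"

text \<open>The weight bounds the number of frozen nodes that a trim starting at \<open>x\<close> may still unlink.\<close>

definition weight :: "('k::linorder, 'v) shared \<Rightarrow> addr \<Rightarrow> nat" where
  "weight sh x = (if x \<in> pub sh \<and> mf (nxn sh x)
     then card {b \<in> pub sh. mf (nxn sh b) \<and> kyn sh x \<le> kyn sh b} else 0)"

definition total_weight :: "('k::linorder, 'v) shared \<Rightarrow> nat" where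
  "total_weight sh = (\<Sum>b\<in>pub sh. weight sh (ref (nxn sh b)))"

section \<open>Effect of flagging and unlinking on the trimmable nodes and the weight\<close>

context
  fixes sh sh' :: "('k::linorder, 'v) shared" and l l' :: "('k, 'v) lst"
  assumes wf: "wf_mem sh" and g: "grows sh sh'" and l: "linv sh l"
begin

interpretation wf_mem sh by (fact wf)

lemma quiet_trimmable: "quiet sh sh' \<Longrightarrow> trimmable sh' = trimmable sh"
  unfolding trimmable_def mark_target_def quiet_def by auto

lemma quiet_weight: "quiet sh sh' \<Longrightarrow> total_weight sh' = total_weight sh"
proof -
  assume q: "quiet sh sh'"
  then have p: "pub sh' = pub sh" and n: "\<And>b. b \<in> pub sh \<Longrightarrow> nxn sh' b = nxn sh b"
    by (auto simp: quiet_def)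
  have k: "\<And>b. b \<in> pub sh \<Longrightarrow> kyn sh' b = kyn sh b" using grows_pub(2)[OF wf g] .
  have w: "weight sh' x = weight sh x" for x
    unfolding weight_def p using n k by (auto intro!: arg_cong[where f=card])
  show ?thesis unfolding total_weight_def p using n by (simp add: w)
qed

text \<open>The flagged node was unfrozen, so it is not the victim and must be the target of a
  marked pointer; it leaves the set. No mark and no target changes, so nothing enters.\<close>

lemma flagging_trimmable:
  assumes f: "flagging sh l sh' l'"
  shows "trimmable sh' \<subset> trimmable sh"
proof -
  let ?c = "l_tcurr l"
  have pc: "l_pc l = T_flag2" and p: "pub sh' = pub sh" and c: "\<not> mf (nxn sh ?c)"
    and n: "nxn sh' = (nxn sh)(?c := setflag (nxn sh ?c))"
    using f by (auto simp: flagging_def)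
  have n': "nxn sh' b = (if b = ?c then setflag (nxn sh ?c) else nxn sh b)" for b
    by (metis n fun_upd_apply)
  have "marked (nxn sh' b) = marked (nxn sh b)" "ref (nxn sh' b) = ref (nxn sh b)" for b
    by (simp_all add: n')
  then have m: "mark_target sh' = mark_target sh" by (simp add: mark_target_def p fun_eq_iff)
  have "?c \<in> pub sh" "mf (nxn sh (l_victim l))" "?c \<noteq> l_victim l \<longrightarrow> mark_target sh ?c"
    using l pc by (auto simp: linv_def trim_ok_def pcs_def)
  then have "?c \<in> trimmable sh" using c by (auto simp: trimmable_def)
  moreover have "?c \<notin> trimmable sh'" by (simp add: trimmable_def n')
  moreover have "trimmable sh' \<subseteq> trimmable sh" by (auto simp: trimmable_def n' m p split: if_splits)
  ultimately show ?thesis by blast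
qed

lemma swinging_facts:
  assumes s: "swinging sh l sh' l'"
  shows "l_pred l \<in> pub sh" "nxn sh (l_pred l) = unm (l_victim l)" "l_victim l \<in> pub sh"
    "mf (nxn sh (l_victim l))" "l_new l \<notin> pub sh" "nxn sh (l_new l) = unm (l_succ l)"
    "pub sh' = insert (l_new l) (pub sh)"
    "nxn sh' b = (if b = l_pred l then unm (l_new l) else nxn sh b)"
    "l_succ l \<noteq> NULL \<Longrightarrow> l_succ l \<in> pub sh \<and> kyn sh (l_victim l) < kyn sh (l_succ l)"
proof -
  have pc: "l_pc l = T_cas" and n: "nxn sh' = (nxn sh)(l_pred l := unm (l_new l))"
    using s by (auto simp: swinging_def)
  show "nxn sh (l_pred l) = unm (l_victim l)" "pub sh' = insert (l_new l) (pub sh)"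
    using s by (auto simp: swinging_def)
  show "nxn sh' b = (if b = l_pred l then unm (l_new l) else nxn sh b)"
    by (metis n fun_upd_apply)
  show "l_pred l \<in> pub sh" "l_victim l \<in> pub sh" "mf (nxn sh (l_victim l))" "l_new l \<notin> pub sh"
    "nxn sh (l_new l) = unm (l_succ l)"
    using l pc by (auto simp: linv_def trim_ok_def find_ok_def pcs_def)
  have "kyn sh (l_victim l) \<le> kyn sh (l_tcurr l)"
    using l pc by (auto simp: linv_def trim_ok_def pcs_def)
  then show "l_succ l \<noteq> NULL \<Longrightarrow> l_succ l \<in> pub sh \<and> kyn sh (l_victim l) < kyn sh (l_succ l)"
    using trim_nodeD(6)[OF l] pc by auto
qed

text \<open>The replaced pointer and the two pointers that become published are unmarked, so the
  targets of marked pointers stay the same. The new node, unpublished before, is not among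
  them.\<close>

lemma swinging_trimmable:
  assumes s: "swinging sh l sh' l'"
  shows "trimmable sh' = trimmable sh"
proof -
  note S = swinging_facts[OF s]
  have "m \<in> pub sh' \<and> marked (nxn sh' m) \<and> ref (nxn sh' m) = b \<longleftrightarrow>
      m \<in> pub sh \<and> marked (nxn sh m) \<and> ref (nxn sh m) = b" for m b
    using S(2,6) by (auto simp: S(7,8))
  then have m: "mark_target sh' b \<longleftrightarrow> mark_target sh b" for b
    by (simp add: mark_target_def Bex_def)
  have "\<not> mark_target sh (l_new l)"
    using S(5) marked_next pub_next pub_alloced by (fastforce simp: mark_target_def)
  then show ?thesis using S(1,2,5) by (auto simp: trimmable_def S(7,8) m)
qed

text \<open>The pointer to the victim is exchanged for one to the new node, of weight 0, and one
  from there to \<open>l_succ\<close>. Since \<open>l_succ\<close> lies strictly beyond the victim,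
  its weight misses at least the victim itself.\<close>

lemma swinging_weight:
  assumes s: "swinging sh l sh' l'"
  shows "total_weight sh' < total_weight sh"
proof -
  note S = swinging_facts[OF s]
  let ?F = "{b \<in> pub sh. mf (nxn sh b)}"
  have k: "\<And>b. b \<in> pub sh \<Longrightarrow> kyn sh' b = kyn sh b" using grows_pub(2)[OF wf g] .
  have F: "b \<in> pub sh' \<and> mf (nxn sh' b) \<longleftrightarrow> b \<in> pub sh \<and> mf (nxn sh b)" for b
    using S(1,2,5,6) by (auto simp: S(7,8))
  have w: "weight sh' x = weight sh x" for x
  proof (cases "x \<in> pub sh \<and> mf (nxn sh x)")
    case True
    then have "{b \<in> pub sh'. mf (nxn sh' b) \<and> kyn sh' x \<le> kyn sh' b}
      = {b \<in> pub sh. mf (nxn sh b) \<and> kyn sh x \<le> kyn sh b}"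
      using True F k by (intro Collect_cong) metis
    then show ?thesis using True F by (simp add: weight_def)
  next
    case False
    then show ?thesis using F by (auto simp: weight_def)
  qed
  \<comment> \<open>By \<open>w\<close> all weights may be evaluated in the old memory, where the
    new node is not yet published.\<close>
  have new0: "weight sh (l_new l) = 0" using S(5) by (simp add: weight_def)
  have fin: "finite {b \<in> pub sh. mf (nxn sh b) \<and> kyn sh (l_victim l) \<le> kyn sh b}"
    using finite_pub by simp
  have v: "weight sh (l_victim l) = card {b \<in> pub sh. mf (nxn sh b) \<and> kyn sh (l_victim l) \<le> kyn sh b}"
    using S(3,4) by (simp add: weight_def)
  have less: "weight sh (l_succ l) < weight sh (l_victim l)"
  proof (cases "l_succ l \<in> pub sh \<and> mf (nxn sh (l_succ l))")
    case True
    then have "l_succ l \<noteq> NULL" by auto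
    then have "kyn sh (l_victim l) < kyn sh (l_succ l)" using S(9) by blast
    then have "{b \<in> pub sh. mf (nxn sh b) \<and> kyn sh (l_succ l) \<le> kyn sh b}
      \<subset> {b \<in> pub sh. mf (nxn sh b) \<and> kyn sh (l_victim l) \<le> kyn sh b}"
      using S(3,4) by (intro psubsetI) (auto dest: equalityD2[THEN subsetD, of _ _ "l_victim l"])
    then show ?thesis
      using True psubset_card_mono[OF fin] unfolding v by (simp add: weight_def)
  next
    case False
    then show ?thesis using S(3,4) fin unfolding v by (auto simp: weight_def card_gt_0_iff)
  qed
  have np: "l_new l \<noteq> l_pred l" using S(1,5) by auto
  have "total_weight sh' = (\<Sum>b\<in>insert (l_new l) (pub sh). weight sh (ref (nxn sh' b)))"
    by (simp add: total_weight_def w S(7))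
  also have "\<dots> = weight sh (l_succ l) + (\<Sum>b\<in>pub sh. weight sh (ref (nxn sh' b)))"
    using S(5) finite_pub np by (simp add: S(6,8))
  also have "(\<Sum>b\<in>pub sh. weight sh (ref (nxn sh' b))) =
    (\<Sum>b\<in>pub sh - {l_pred l}. weight sh (ref (nxn sh b)))"
    using S(1) finite_pub new0 by (simp add: sum.remove[of _ "l_pred l"] S(8))
  finally have "total_weight sh' =
    weight sh (l_succ l) + (\<Sum>b\<in>pub sh - {l_pred l}. weight sh (ref (nxn sh b)))" .
  moreover have "total_weight sh =
    weight sh (l_victim l) + (\<Sum>b\<in>pub sh - {l_pred l}. weight sh (ref (nxn sh b)))"
    using S(1) finite_pub by (simp add: total_weight_def sum.remove[of _ "l_pred l"] S(2))
  ultimately show ?thesis using less by simp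
qed

end

section \<open>Stages of an operation\<close>

definition done_pcs :: "pc set" where
  "done_pcs = find_pcs \<union> trim_pcs \<union> {T_nts, T_ntsc, R_fin}"

text \<open>Stage 0: the operation has already taken effect by its insertion or its mark.\<close>

definition stage :: "('k, 'v) lst \<Rightarrow> nat" where
  "stage l = (if l_op l = None then 2
     else if l_pc l \<in> {I_ts, I_tsc} \<or> l_pc l \<in> done_pcs \<and> l_fret l = RRem2 then 0 else 1)"

lemma exec_op: "case exec sh l of (sh', l', a) \<Rightarrow> a \<noteq> ARet \<longrightarrow> l_op l' = l_op l"
  by (cases "l_pc l")
    (simp_all add: exec_def withn_def goto_def ret_def split: option.splits oper.splits)

lemma exec_act: "case exec sh l of (sh', l', a) \<Rightarrow> a \<noteq> AInv"
  by (cases "l_pc l")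
    (simp_all add: exec_def withn_def goto_def ret_def split: option.splits oper.splits)

text \<open>After its mark a removal runs one more \<open>find\<close> and then completes, whatever
  that \<open>find\<close> returns, so it never comes back to another mark.\<close>

lemma exec_done:
  assumes "l_pc l \<in> done_pcs" "l_fret l = RRem2"
  shows "case exec sh l of (sh', l', a) \<Rightarrow> a \<noteq> ARet \<longrightarrow> l_pc l' = Err \<or> l_pc l' \<in> done_pcs \<and> l_fret l' = RRem2"
  using assms(1)[unfolded done_pcs_def pcs_def] assms(2)
  by (elim UnE insertE emptyE)
    ((simp add: exec_def withn_def goto_def ret_def split: option.splits,
      (simp add: done_pcs_def pcs_def)?)[1])+

lemma exec_inserted:
  assumes "l_pc l \<in> {I_ts, I_tsc}"
  shows "case exec sh l of (sh', l', a) \<Rightarrow> a \<noteq> ARet \<longrightarrow> l_pc l' = Err \<or> l_pc l' = I_tsc"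
  using assms
  by (elim insertE emptyE)
    (simp_all add: exec_def withn_def goto_def ret_def split: option.splits)

lemma stage_exec:
  assumes "linv sh' l'" "l_op l \<noteq> None" "exec sh l = (sh', l', a)" "a \<noteq> ARet"
  shows "stage l' \<le> stage l" "inserting l l' \<or> marking l l' \<Longrightarrow> stage l' < stage l"
proof -
  have o: "l_op l' = l_op l" using exec_op[where l=l and sh=sh] assms by simp
  have e: "l_pc l' \<noteq> Err" using assms by (simp add: linv_def pc_ok_def)
  have i: "l_pc l' = I_tsc" if "l_pc l \<in> {I_ts, I_tsc}"
    using exec_inserted[where sh=sh, OF that] assms(3,4) e by simp
  have d: "l_pc l' \<in> done_pcs \<and> l_fret l' = RRem2" if "l_pc l \<in> done_pcs" "l_fret l = RRem2"
    using exec_done[where sh=sh, OF that] assms(3,4) e by simp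
  obtain y where "l_op l = Some y" using assms(2) by blast
  note op = this o[unfolded this]
  show "stage l' \<le> stage l"
  proof (cases "l_pc l \<in> {I_ts, I_tsc} \<or> l_pc l \<in> done_pcs \<and> l_fret l = RRem2")
    case True
    then have "l_pc l' = I_tsc \<or> l_pc l' \<in> done_pcs \<and> l_fret l' = RRem2" using i d by blast
    then show ?thesis by (simp add: stage_def op)
  qed (simp add: stage_def op)
  have n: "I_cas \<notin> done_pcs" "R_mark2 \<notin> done_pcs" "F_retry \<in> done_pcs"
    by (simp_all add: done_pcs_def pcs_def)
  show "stage l' < stage l" if "inserting l l' \<or> marking l l'"
    using that
  proof
    assume "inserting l l'"
    then show ?thesis by (simp add: stage_def inserting_def op n)
  next
    assume "marking l l'"
    then show ?thesis by (simp add: stage_def marking_def op n)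
  qed
qed

text \<open>Without distinct pending nodes, a CAS of one thread could publish the node that another
  thread still relies on as unpublished.\<close>

definition ginv :: "('k::linorder, 'v, 't) gstate \<Rightarrow> bool" where
  "ginv st \<longleftrightarrow> wf_mem (fst st) \<and> (\<forall>t. linv (fst st) (snd st t)) \<and>
     (\<forall>t t'. t \<noteq> t' \<longrightarrow> l_pc (snd st t) \<in> {T_cas, I_cas} \<longrightarrow> l_pc (snd st t') \<in> {T_cas, I_cas} \<longrightarrow>
        l_new (snd st t) \<noteq> l_new (snd st t'))"

lemma init_wf_mem:
  assumes "is_init st"
  shows "wf_mem (fst st)"
proof -
  obtain v1 v2 where m: "s_mem (fst st) = (\<lambda>a. None)(HEAD := Some (mknode 2 NegInf v1 (unm TAIL) NULL),
      TAIL := Some (mknode 2 PosInf v2 (unm NULL) NULL))"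
    and gf: "s_gts (fst st) = 2" "s_free (fst st) = 3"
    using assms by (auto simp: is_init_def)
  have al: "alloced (fst st) b \<longleftrightarrow> b = HEAD \<or> b = TAIL" for b
    by (auto simp: alloced_def m)
  have nd: "nd (fst st) HEAD = mknode 2 NegInf v1 (unm TAIL) NULL"
    "nd (fst st) TAIL = mknode 2 PosInf v2 (unm NULL) NULL"
    by (auto simp: nd_def m HEAD_def TAIL_def)
  have ne: "HEAD \<noteq> TAIL" "HEAD \<noteq> NULL" "TAIL \<noteq> NULL"
    by (simp_all add: HEAD_def TAIL_def NULL_def)
  show ?thesis
  proof
    fix b
    show "alloced (fst st) b \<longleftrightarrow> 0 < b \<and> b < s_free (fst st)"
      by (auto simp: al gf HEAD_def TAIL_def)
    show "good (fst st) b (ref (nxn (fst st) b))"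
      if "alloced (fst st) b" "tsn (fst st) b \<noteq> BOT" "ref (nxn (fst st) b) \<noteq> NULL"
      using that by (auto simp: al nd BOT_def intro!: good.good_stop)
  qed (use ne in \<open>auto simp: al nd gf BOT_def\<close>)
qed

lemma linv_idle: "l_op l = None \<Longrightarrow> l_pc l = Idle \<Longrightarrow> linv sh l"
  by (simp add: linv_unfolded)

lemma ginv_init: "is_init st \<Longrightarrow> ginv st"
  using init_wf_mem[of st] by (simp add: ginv_def is_init_def linv_idle)

lemma linv_cas_new:
  assumes "l_pc l \<in> {T_cas, I_cas}" "linv sh l"
  shows "alloced sh (l_new l)" "l_new l \<notin> pub sh"
proof -
  have "alloced sh (l_new l) \<and> l_new l \<notin> pub sh"
    using assms by (elim insertE emptyE) (simp_all add: linv_def trim_ok_def op_rest_ok_def)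
  then show "alloced sh (l_new l)" "l_new l \<notin> pub sh" by auto
qed

lemma linv_invoke: "linv sh (invoke opn l)"
  by (cases opn) (simp_all add: linv_unfolded)

lemma ginvI:
  assumes "wf_mem sh" "linv sh l" "\<And>x. x \<noteq> t \<Longrightarrow> linv sh (L x)"
    and "\<And>x y. x \<noteq> y \<Longrightarrow> l_pc (L x) \<in> {T_cas, I_cas} \<Longrightarrow> l_pc (L y) \<in> {T_cas, I_cas} \<Longrightarrow>
      l_new (L x) \<noteq> l_new (L y)"
    and "\<And>x. l_pc l \<in> {T_cas, I_cas} \<Longrightarrow> l_pc (L x) \<in> {T_cas, I_cas} \<Longrightarrow> l_new (L x) \<noteq> l_new l"
  shows "ginv (sh, L(t := l))"
  unfolding ginv_def fst_conv snd_conv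
proof (intro conjI allI impI)
  fix x y
  assume "x \<noteq> y" "l_pc ((L(t := l)) x) \<in> {T_cas, I_cas}" "l_pc ((L(t := l)) y) \<in> {T_cas, I_cas}"
  then show "l_new ((L(t := l)) x) \<noteq> l_new ((L(t := l)) y)"
    using assms(4)[of x y] assms(5)[of x] assms(5)[of y] by (cases "x = t"; cases "y = t") simp_all
qed (use assms(1-3) in auto)

lemma ginv_step:
  assumes "gstep st t a st'" "ginv st"
  shows "ginv st'"
  using assms
proof cases
  case (invoke_step L sh opn)
  have "l_pc (invoke opn (L t)) \<notin> {T_cas, I_cas}" by (cases opn) simp_all
  then show ?thesis
    using assms(2) unfolding invoke_step
    by (intro ginvI; unfold ginv_def fst_conv snd_conv) (blast intro: linv_invoke)+
next
  case (exec_step L sh sh' l')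
  have wf: "wf_mem sh" and li: "\<And>t. linv sh (L t)"
    and d: "\<And>t t'. t \<noteq> t' \<Longrightarrow> l_pc (L t) \<in> {T_cas, I_cas} \<Longrightarrow> l_pc (L t') \<in> {T_cas, I_cas} \<Longrightarrow>
      l_new (L t) \<noteq> l_new (L t')"
    using assms(2) unfolding exec_step ginv_def fst_conv snd_conv by blast+
  interpret wf_mem sh by fact
  have s: "step_ok sh (L t) sh' l'" using exec_step_ok[OF li] exec_step by blast
  then have s': "wf_mem sh'" "grows sh sh'" "linv sh' l'"
    "pub sh' \<subseteq> (if l_pc (L t) \<in> {T_cas, I_cas} then insert (l_new (L t)) (pub sh) else pub sh)"
    "l_pc l' \<in> {T_cas, I_cas} \<Longrightarrow> l_new l' = s_free sh"
    by (simp_all only: step_ok_def)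
  note n = linv_cas_new[OF _ li]
  have "linv sh' (L x)" if x: "x \<noteq> t" for x
  proof (rule linv_grows[OF wf s'(2) li])
    assume c: "l_pc (L x) \<in> {T_cas, I_cas}"
    show "l_new (L x) \<notin> pub sh'"
    proof
      assume "l_new (L x) \<in> pub sh'"
      from subsetD[OF s'(4) this] have "l_pc (L t) \<in> {T_cas, I_cas} \<and> l_new (L x) = l_new (L t)"
        using n(2)[OF c] by (cases "l_pc (L t) \<in> {T_cas, I_cas}") simp_all
      then show False using d[OF x c] by simp
    qed
  qed
  moreover have "l_new (L x) \<noteq> l_new l'"
    if "l_pc l' \<in> {T_cas, I_cas}" "l_pc (L x) \<in> {T_cas, I_cas}" for x
    using s'(5)[OF that(1)] n(1)[OF that(2)] by (simp add: alloced_iff)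
  ultimately show ?thesis
    unfolding exec_step by (intro ginvI s'(1,3) d)
qed

section \<open>Descent along an execution without completions\<close>

lemma eventually_constant:
  fixes f :: "nat \<Rightarrow> nat"
  assumes "\<And>i. n \<le> i \<Longrightarrow> f (Suc i) \<le> f i"
  shows "\<exists>N\<ge>n. \<forall>i\<ge>N. f (Suc i) = f i"
proof -
  obtain N where N: "N \<ge> n" "\<And>i. i \<ge> n \<Longrightarrow> f N \<le> f i"
    using ex_has_least_nat[of "\<lambda>i. i \<ge> n" n f] by blast
  have "f i = f N" if "i \<ge> N" for i
    using that
  proof (induction rule: dec_induct)
    case (step i)
    then show ?case using assms[of i] N(2)[of "Suc i"] N(1) by linarith
  qed simp
  then show ?thesis using N(1) by (metis le_SucI)
qed

text \<open>The balance is kept additive on both sides to avoid subtraction of natural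
  numbers.\<close>

lemma sum_fun_upd:
  fixes f :: "'a \<Rightarrow> nat" and L :: "'t::finite \<Rightarrow> 'a"
  shows "(\<Sum>x\<in>UNIV. f ((L(t := y)) x)) + f (L t) = (\<Sum>x\<in>UNIV. f (L x)) + f y"
proof -
  have "(\<Sum>x\<in>UNIV. f ((L(t := y)) x)) = f y + (\<Sum>x\<in>UNIV - {t}. f ((L(t := y)) x))"
    by (subst sum.remove[of UNIV t]) simp_all
  also have "(\<Sum>x\<in>UNIV - {t}. f ((L(t := y)) x)) = (\<Sum>x\<in>UNIV - {t}. f (L x))"
    by (intro sum.cong) simp_all
  finally show ?thesis
    using sum.remove[of UNIV t "\<lambda>x. f (L x)"] by simp
qed

lemma gstep_facts:
  assumes "gstep (sh, L) t a (sh', L')"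
  shows "a = AInv \<and> l_op (L t) = None \<and> l_op (L' t) \<noteq> None \<or>
      l_op (L t) \<noteq> None \<and> exec sh (L t) = (sh', L' t, a)"
    and "L' = L(t := L' t)"
proof -
  have "(a = AInv \<and> l_op (L t) = None \<and> l_op (L' t) \<noteq> None \<or>
      l_op (L t) \<noteq> None \<and> exec sh (L t) = (sh', L' t, a)) \<and> L' = L(t := L' t)"
    using assms
  proof cases
    case (invoke_step opn)
    have "l_op (invoke opn (L t)) \<noteq> None" by (cases opn) simp_all
    then show ?thesis using invoke_step by simp
  next
    case (exec_step l')
    then show ?thesis by simp
  qed
  then show "a = AInv \<and> l_op (L t) = None \<and> l_op (L' t) \<noteq> None \<or>
      l_op (L t) \<noteq> None \<and> exec sh (L t) = (sh', L' t, a)"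
    and "L' = L(t := L' t)" by blast+
qed

theorem theorem49:
  fixes \<sigma> :: "nat \<Rightarrow> ('k::linorder, 'v, 't::finite) gstate"
    and thr :: "nat \<Rightarrow> 't"
    and a :: "nat \<Rightarrow> act"
  assumes "is_init (\<sigma> 0)"
    and "\<forall>i. gstep (\<sigma> i) (thr i) (a i) (\<sigma> (Suc i))"
  shows "\<forall>n. \<exists>m\<ge>n. a m = ARet"
proof (rule ccontr)
  assume "\<not> (\<forall>n. \<exists>m\<ge>n. a m = ARet)"
  then obtain n where n: "\<And>m. m \<ge> n \<Longrightarrow> a m \<noteq> ARet" by blast
  define sh where "sh i = fst (\<sigma> i)" for i
  define L where "L i = snd (\<sigma> i)" for i
  have \<sigma>: "\<sigma> i = (sh i, L i)" for i by (simp add: sh_def L_def)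
  have inv: "ginv (\<sigma> i)" for i
  proof (induction i)
    case 0
    show ?case using ginv_init[OF assms(1)] .
  next
    case (Suc i)
    show ?case using ginv_step[OF assms(2)[rule_format] Suc] .
  qed
  then have wf: "wf_mem (sh i)" and li: "linv (sh i) (L i t)" for i t
    unfolding ginv_def sh_def L_def by blast+
  have step: "a i = AInv \<and> l_op (L i (thr i)) = None \<and> l_op (L (Suc i) (thr i)) \<noteq> None \<or>
      l_op (L i (thr i)) \<noteq> None \<and> exec (sh i) (L i (thr i)) = (sh (Suc i), L (Suc i) (thr i), a i)"
    and upd: "L (Suc i) = (L i)(thr i := L (Suc i) (thr i))" for i
  proof -
    have "gstep (sh i, L i) (thr i) (a i) (sh (Suc i), L (Suc i))"
      using assms(2) by (simp add: \<sigma>[symmetric])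
    from gstep_facts[OF this]
    show "a i = AInv \<and> l_op (L i (thr i)) = None \<and> l_op (L (Suc i) (thr i)) \<noteq> None \<or>
      l_op (L i (thr i)) \<noteq> None \<and> exec (sh i) (L i (thr i)) = (sh (Suc i), L (Suc i) (thr i), a i)"
      "L (Suc i) = (L i)(thr i := L (Suc i) (thr i))" .
  qed
  let ?l = "\<lambda>i. L i (thr i)" and ?l' = "\<lambda>i. L (Suc i) (thr i)"
  have ok: "step_ok (sh i) (?l i) (sh (Suc i)) (?l' i)" if "l_op (?l i) \<noteq> None" for i
    using wf_mem.exec_step_ok[OF wf li that] step[of i] that by blast

  \<comment> \<open>Without completions no stage rises; an invocation lowers it from 2 to 1, an
    insertion or a mark from 1 to 0. The sum over the finitely many threads therefore bounds all
    three kinds of events.\<close>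
  have st: "stage (?l' i) \<le> stage (?l i)"
    "a i = AInv \<or> inserting (?l i) (?l' i) \<or> marking (?l i) (?l' i) \<Longrightarrow> stage (?l' i) < stage (?l i)"
    if i: "i \<ge> n" for i
  proof -
    have lt: "stage (?l' i) < stage (?l i)" if "a i = AInv" "l_op (?l i) = None" "l_op (?l' i) \<noteq> None"
      using that by (simp add: stage_def)
    have ex: "a i \<noteq> AInv" if "l_op (?l i) \<noteq> None" "exec (sh i) (?l i) = (sh (Suc i), ?l' i, a i)"
      using exec_act[where sh="sh i" and l="?l i"] that by simp
    note se = stage_exec[OF li[of "Suc i"], where a="a i", OF _ _ n[OF i]]
    show "stage (?l' i) \<le> stage (?l i)"
      using step[of i] lt se(1) by (elim disjE conjE) auto
    show "stage (?l' i) < stage (?l i)"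
      if "a i = AInv \<or> inserting (?l i) (?l' i) \<or> marking (?l i) (?l' i)"
      using that step[of i] lt se(2) ex by (elim disjE conjE) auto
  qed
  define S where "S i = (\<Sum>t\<in>UNIV. stage (L i t))" for i
  have S: "S (Suc i) + stage (?l i) = S i + stage (?l' i)" for i
    using sum_fun_upd[of stage "L i" "thr i" "?l' i"] upd[of i] by (simp add: S_def)
  have "S (Suc i) \<le> S i" if "i \<ge> n" for i using S[of i] st(1)[OF that] by linarith
  then obtain n1 where n1: "n1 \<ge> n" "\<And>i. i \<ge> n1 \<Longrightarrow> S (Suc i) = S i"
    using eventually_constant[of n S] by blast
  have no1: "a i \<noteq> AInv" "\<not> inserting (?l i) (?l' i)" "\<not> marking (?l i) (?l' i)" if "i \<ge> n1" for i
    using S[of i] n1(2)[OF that] st(2)[of i] n1(1) that by fastforce+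
  have e1: "l_op (?l i) \<noteq> None" "exec (sh i) (?l i) = (sh (Suc i), ?l' i, a i)" if "i \<ge> n1" for i
    using step[of i] no1(1)[OF that] by blast+
  have g: "grows (sh i) (sh (Suc i))" if "i \<ge> n1" for i
    using ok[OF e1(1)[OF that]] by (simp only: step_ok_def)
  have c1: "quiet (sh i) (sh (Suc i)) \<or> flagging (sh i) (?l i) (sh (Suc i)) (?l' i) \<or>
      swinging (sh i) (?l i) (sh (Suc i)) (?l' i)" if "i \<ge> n1" for i
    using ok[OF e1(1)[OF that]] no1(2,3)[OF that] unfolding step_ok_def by blast

  \<comment> \<open>Only flagging still changes the trimmable set, and it shrinks it, so flags come
    to an end as well.\<close>
  have fin: "finite (trimmable (sh i))" for i
    using wf_mem.finite_pub[OF wf] by (simp add: trimmable_def)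
  have c2: "trimmable (sh (Suc i)) \<subseteq> trimmable (sh i)"
    "flagging (sh i) (?l i) (sh (Suc i)) (?l' i) \<Longrightarrow> trimmable (sh (Suc i)) \<subset> trimmable (sh i)"
    if "i \<ge> n1" for i
    using c1[OF that] quiet_trimmable[OF wf g li, OF that] flagging_trimmable[OF wf g li, OF that]
      swinging_trimmable[OF wf g li, OF that] by (blast, blast)
  have "card (trimmable (sh (Suc i))) \<le> card (trimmable (sh i))" if "i \<ge> n1" for i
    using card_mono[OF fin c2(1)[OF that]] .
  then obtain n2 where n2: "n2 \<ge> n1"
    "\<And>i. i \<ge> n2 \<Longrightarrow> card (trimmable (sh (Suc i))) = card (trimmable (sh i))"
    using eventually_constant[of n1 "\<lambda>i. card (trimmable (sh i))"] by blast
  have c3: "quiet (sh i) (sh (Suc i)) \<or> swinging (sh i) (?l i) (sh (Suc i)) (?l' i)" if "i \<ge> n2" for i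
  proof -
    have i: "i \<ge> n1" using that n2(1) by simp
    show ?thesis using c1[OF i] psubset_card_mono[OF fin c2(2)[OF i]] n2(2)[OF that] by fastforce
  qed

  have c4: "total_weight (sh (Suc i)) \<le> total_weight (sh i)"
    "swinging (sh i) (?l i) (sh (Suc i)) (?l' i) \<Longrightarrow> total_weight (sh (Suc i)) < total_weight (sh i)"
    if "i \<ge> n2" for i
  proof -
    have i: "i \<ge> n1" using that n2(1) by simp
    show "swinging (sh i) (?l i) (sh (Suc i)) (?l' i) \<Longrightarrow> total_weight (sh (Suc i)) < total_weight (sh i)"
      using swinging_weight[OF wf g li, OF i] .
    then show "total_weight (sh (Suc i)) \<le> total_weight (sh i)"
      using c3[OF that] quiet_weight[OF wf g li, OF i] by fastforce
  qed
  then obtain n3 where n3: "n3 \<ge> n2" "\<And>i. i \<ge> n3 \<Longrightarrow> total_weight (sh (Suc i)) = total_weight (sh i)"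
    using eventually_constant[of n2 "\<lambda>i. total_weight (sh i)"] by blast
  have q: "quiet (sh i) (sh (Suc i))" if "i \<ge> n3" for i
    using c3[of i] c4(2)[of i] n3 that by fastforce

  \<comment> \<open>Pigeonhole over the finite type of threads: some thread \<open>t\<close> steps
    infinitely often.\<close>
  have "{n3..} = (\<Union>t. {i. n3 \<le> i \<and> thr i = t})" by auto
  then have "infinite (\<Union>t. {i. n3 \<le> i \<and> thr i = t})" using infinite_Ici[of n3] by metis
  then obtain t where t: "infinite {i. n3 \<le> i \<and> thr i = t}"
    using finite_UN_I[of UNIV "\<lambda>t. {i. n3 \<le> i \<and> thr i = t}"] by auto
  define p where "p i = progress (sh i) (L i t)" for i
  have qp: "progress (sh (Suc i)) x = progress (sh i) x" if "i \<ge> n3" for i x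
    using quiet_progress[OF wf g q] that n2(1) n3(1) by simp
  have p_own: "(p (Suc i), p i) \<in> progress_rel" if "i \<ge> n3" "thr i = t" for i
  proof -
    have i: "i \<ge> n1" "i \<ge> n" using that n1 n2(1) n3(1) by simp_all
    show ?thesis
      using wf_mem.quiet_step_progress[OF wf li e1(1)[OF i(1)]] e1(2)[OF i(1)] q[OF that(1)] n[OF i(2)]
      unfolding p_def qp[OF that(1)] that(2) by simp
  qed
  have p_other: "p (Suc i) = p i" if "i \<ge> n3" "thr i \<noteq> t" for i
  proof -
    have "L (Suc i) t = L i t" using that(2) by (subst upd) simp
    then show ?thesis unfolding p_def qp[OF that(1)] by simp
  qed
  \<comment> \<open>Once the progress of \<open>t\<close> has reached a minimal value, another step
    of \<open>t\<close> would undercut it, while steps of other threads keep it; so \<open>t\<close>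
    never steps again.\<close>
  obtain z where z: "z \<in> p ` {n3..}" "\<And>y. (y, z) \<in> progress_rel \<Longrightarrow> y \<notin> p ` {n3..}"
    by (rule wfE_min[OF wf_progress_rel, of "p n3" "p ` {n3..}"]) blast+
  from z(1) obtain i where i: "i \<ge> n3" "z = p i" by (elim imageE) simp
  have min: "(p j, p i) \<notin> progress_rel" if "j \<ge> n3" for j
    using z(2)[of "p j"] that unfolding i(2) by blast
  have j: "p j = p i \<and> thr j \<noteq> t" if "j \<ge> i" for j
    using that
  proof (induction rule: dec_induct)
    case base
    show ?case using p_own[OF i(1)] min[OF le_SucI[OF i(1)]] by blast
  next
    case (step j)
    have n: "j \<ge> n3" "Suc j \<ge> n3" "Suc (Suc j) \<ge> n3" using step(1) i(1) by simp_all
    have "p (Suc j) = p i" using p_other[OF n(1)] step.IH by simp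
    moreover have "thr (Suc j) \<noteq> t"
      using p_own[OF n(2)] min[OF n(3)] unfolding \<open>p (Suc j) = p i\<close> by blast
    ultimately show ?case ..
  qed
  have "{i. n3 \<le> i \<and> thr i = t} \<subseteq> {..<i}"
  proof
    fix k assume "k \<in> {i. n3 \<le> i \<and> thr i = t}"
    then show "k \<in> {..<i}" using j[of k] by (cases "i \<le> k") simp_all
  qed
  from finite_subset[OF this] t show False by simp
qed

end
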